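(* Let $X\in L^\infty(\mathcal{F}_T)$. For $0\le s\le t\le T$ and $\eta\in L^0(\mathcal{F}_s)$ with values in $\mathrm{dom}(l^* )$ we have $$v(X,s,\eta)=\operatorname*{ess\,sup}_{\substack{Z\in L^1_+(\mathcal{F}_t)\\ \eta Z\in\mathrm{dom}(l^* ),\ E[Z|\mathcal{F}_s]=1}}E\left[\operatorname*{ess\,inf}_{r\in\mathbb{R}}\bigl\{E[l(X-r)|\mathcal{F}_t]+r\eta Z\bigr\}\,\Big|\,\mathcal{F}_s\right]=\operatorname*{ess\,sup}_{\substack{Z\in L^1_+(\mathcal{F}_t)\\ \eta Z\in\mathrm{dom}(l^* ),\ E[Z|\mathcal{F}_s]=1}}E\left[v(X,t,\eta Z)\,|\,\mathcal{F}_s\right].$$ In particular, $$\rho(X)=\sup_{\substack{Z\in L^1_+(\mathcal{F}_t)\\ Z\in\mathrm{dom}(l^* ),\ E[Z]=1}}E\left[\operatorname*{ess\,inf}_{r\in\mathbb{R}}\bigl(E[l(X-r)|\mathcal{F}_t]+rZ\bigr)\right].$$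
   Context: $T\in(0,\infty)$; $(\Omega,\mathcal{F},P)$ is a probability space with the completed filtration $(\mathcal{F}_t)_{t\in[0,T]}$ of a $d$-dimensional Brownian motion, and $\mathcal{F}=\mathcal{F}_T$. $L^1_+(\mathcal{F}_t)$ is the set of non-negative integrable $\mathcal{F}_t$-measurable random variables and $L^0(\mathcal{F}_s)$ the set of $\mathcal{F}_s$-measurable random variables. (In)equalities between random variables are $P$-a.s.; writing "$\xi\in\mathrm{dom}(l^* )$" for a random variable $\xi$ means that $\xi$ takes values in $\mathrm{dom}(l^* )$ a.s. $l:\mathbb{R}\to\mathbb{R}$ is a loss function: convex, increasing (non-decreasing), $l(0)=0$; $l^*(z):=\sup_{x\in\mathbb{R}}\{xz-l(x)\}$ for $z\ge0$, $\mathrm{dom}(l^* ):=\{z\in\mathbb{R}_+:l^*(z)<\infty\}$. Standing assumptions: (N) $l^*(1)=0$; (C) $l(x)>x$ for all $x$ with $|x|$ large enough. The optimized certainty equivalent is $\rho(X):=\inf_{r\in\mathbb{R}}(E[l(X-r)]+r)$, $X\in L^\infty$. For $s\in[0,T]$ and $\eta\in L^0(\mathcal{F}_s)$, $$v(X,s,\eta):=\operatorname*{ess\,inf}_{r\in\mathbb{R}}\{E[l(X-r)|\mathcal{F}_s]+r\eta\},$$ so that $\rho(X)=v(X,0,1)$. (Since $v(X,t,\cdot)\le E[l(X)|\mathcal{F}_t]$ is bounded above, the conditional expectations in the claim are well defined in $[-\infty,\infty)$.) *)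

theory Defs
  imports "HOL-Probability.Probability"
begin

section \<open>Essential suprema and infima of families of random variables\<close>

text \<open>
  The library's \<open>esssup\<close> is the essential supremum of one function, a number.  Here we need the
  essential supremum of a (possibly uncountable) family of random variables, which is a random
  variable, unique up to almost sure equality.
\<close>

definition is_ess_Sup :: "'w measure \<Rightarrow> 'i set \<Rightarrow> ('i \<Rightarrow> 'w \<Rightarrow> ereal) \<Rightarrow> ('w \<Rightarrow> ereal) \<Rightarrow> bool" where
  "is_ess_Sup M I f Y \<longleftrightarrow>
     Y \<in> borel_measurable M \<and>
     (\<forall>i\<in>I. AE \<omega> in M. f i \<omega> \<le> Y \<omega>) \<and>
     (\<forall>Y'\<in>borel_measurable M. (\<forall>i\<in>I. AE \<omega> in M. f i \<omega> \<le> Y' \<omega>) \<longrightarrow> (AE \<omega> in M. Y \<omega> \<le> Y' \<omega>))"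

definition is_ess_Inf :: "'w measure \<Rightarrow> 'i set \<Rightarrow> ('i \<Rightarrow> 'w \<Rightarrow> ereal) \<Rightarrow> ('w \<Rightarrow> ereal) \<Rightarrow> bool" where
  "is_ess_Inf M I f Y \<longleftrightarrow>
     Y \<in> borel_measurable M \<and>
     (\<forall>i\<in>I. AE \<omega> in M. Y \<omega> \<le> f i \<omega>) \<and>
     (\<forall>Y'\<in>borel_measurable M. (\<forall>i\<in>I. AE \<omega> in M. Y' \<omega> \<le> f i \<omega>) \<longrightarrow> (AE \<omega> in M. Y' \<omega> \<le> Y \<omega>))"

definition ess_Sup :: "'w measure \<Rightarrow> 'i set \<Rightarrow> ('i \<Rightarrow> 'w \<Rightarrow> ereal) \<Rightarrow> 'w \<Rightarrow> ereal" where
  "ess_Sup M I f = (SOME Y. is_ess_Sup M I f Y)"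

definition ess_Inf :: "'w measure \<Rightarrow> 'i set \<Rightarrow> ('i \<Rightarrow> 'w \<Rightarrow> ereal) \<Rightarrow> 'w \<Rightarrow> ereal" where
  "ess_Inf M I f = (SOME Y. is_ess_Inf M I f Y)"

text \<open>
  On a finite measure space every family of measurable functions has an essential supremum and an
  essential infimum, so the choices above are meaningful.
\<close>

lemma (in finite_measure) ess_Union_exists:
  assumes A: "\<And>i. i \<in> I \<Longrightarrow> A i \<in> sets M"
  shows "\<exists>J. countable J \<and> J \<subseteq> I \<and> (\<forall>i\<in>I. emeasure M (A i - (\<Union>j\<in>J. A j)) = 0)"
proof -
  define C where "C = {J. countable J \<and> J \<subseteq> I}"
  define m where "m J = emeasure M (\<Union>j\<in>J. A j)" for J
  have "C \<noteq> {}" by (auto simp: C_def)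
  then obtain g :: "nat \<Rightarrow> ennreal" where g: "range g \<subseteq> m ` C" "Sup (m ` C) = Sup (range g)"
    using ennreal_SUP_countable_SUP[of C m] by auto
  then have "\<forall>n. \<exists>J\<in>C. g n = m J" by blast
  then obtain Jn where Jn: "\<And>n. Jn n \<in> C" "\<And>n. g n = m (Jn n)" by metis
  define J where "J = (\<Union>n. Jn n)"
  have JC: "J \<in> C" using Jn(1) by (auto simp: J_def C_def)
  have meas: "(\<Union>j\<in>K. A j) \<in> sets M" if "K \<in> C" for K
    using that A by (intro sets.countable_UN') (auto simp: C_def)
  have "m (Jn n) \<le> m J" for n
    unfolding m_def by (intro emeasure_mono meas JC) (auto simp: J_def)
  then have Sup_le: "Sup (m ` C) \<le> m J"
    unfolding g(2) Jn(2)[abs_def] by (auto intro: SUP_least)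
  have "emeasure M (A i - (\<Union>j\<in>J. A j)) = 0" if i: "i \<in> I" for i
  proof -
    have iJ: "insert i J \<in> C" using JC i by (auto simp: C_def)
    have "m (insert i J) \<le> m J"
      using Sup_le Sup_upper[of "m (insert i J)" "m ` C"] iJ by (auto intro: order_trans)
    moreover have "m (insert i J) = emeasure M (A i - (\<Union>j\<in>J. A j)) + m J"
      unfolding m_def using A[OF i] meas[OF JC]
      by (subst plus_emeasure) (auto intro!: arg_cong[where f="emeasure M"])
    moreover have "m J \<noteq> \<infinity>" by (simp add: m_def)
    ultimately show ?thesis
      using ennreal_add_left_cancel_le[of "m J" "emeasure M (A i - (\<Union>j\<in>J. A j))" 0]
      by (simp add: add.commute)
  qed
  then show ?thesis using JC by (auto simp: C_def)
qed

lemma (in finite_measure) ess_Sup_exists: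
  assumes f [measurable]: "\<And>i. i \<in> I \<Longrightarrow> f i \<in> borel_measurable M"
  shows "\<exists>Y. is_ess_Sup M I f Y"
proof -
  define A where "A q i = {\<omega>\<in>space M. ereal (of_rat q) < f i \<omega>}" for q :: rat and i
  have "\<exists>J. countable J \<and> J \<subseteq> I \<and> (\<forall>i\<in>I. emeasure M (A q i - (\<Union>j\<in>J. A q j)) = 0)" for q
    by (rule ess_Union_exists) (simp add: A_def)
  then obtain J where J: "\<And>q. countable (J q)" "\<And>q. J q \<subseteq> I"
    "\<And>q i. i \<in> I \<Longrightarrow> emeasure M (A q i - (\<Union>j\<in>J q. A q j)) = 0" by metis
  define K where "K = (\<Union>q. J q)"
  have K: "countable K" "K \<subseteq> I" using J by (auto simp: K_def)
  define Y where "Y \<omega> = (SUP j\<in>K. f j \<omega>)" for \<omega>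
  have Y: "Y \<in> borel_measurable M"
    unfolding Y_def using K by (intro borel_measurable_SUP) auto
  have "AE \<omega> in M. f i \<omega> \<le> Y \<omega>" if i: "i \<in> I" for i
  proof -
    have "AE \<omega> in M. \<forall>q. \<omega> \<notin> A q i - (\<Union>j\<in>J q. A q j)"
    proof (subst AE_all_countable, intro allI AE_not_in)
      fix q
      have "A q i - (\<Union>j\<in>J q. A q j) \<in> sets M"
        using J(1,2)[of q] i by (intro sets.Diff sets.countable_UN') (auto simp: A_def)
      then show "A q i - (\<Union>j\<in>J q. A q j) \<in> null_sets M" using J(3)[OF i] by blast
    qed
    then show ?thesis using AE_space
    proof eventually_elim
      case (elim \<omega>)
      show ?case
      proof (rule ccontr)
        assume "\<not> ?thesis"
        then obtain z where z: "Y \<omega> < ereal z" "ereal z < f i \<omega>"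
          using ereal_dense2[of "Y \<omega>" "f i \<omega>"] by (auto simp: not_le)
        obtain z' where z': "ereal z < ereal z'" "ereal z' < f i \<omega>"
          using ereal_dense2[OF z(2)] by blast
        obtain q where q: "z < of_rat q" "of_rat q < z'" using of_rat_dense z'(1) by auto
        have "\<omega> \<in> A q i"
          using elim(2) q(2) z'(2) by (auto simp: A_def intro: order_less_trans[of _ "ereal z'"])
        then obtain j where j: "j \<in> J q" "ereal (of_rat q) < f j \<omega>"
          using elim(1) by (auto simp: A_def)
        then have "f j \<omega> \<le> Y \<omega>" unfolding Y_def K_def by (intro SUP_upper) auto
        moreover have "ereal z < ereal (of_rat q)" using q(1) by simp
        ultimately show False using j(2) z(1) by order
      qed
    qed
  qed
  moreover have "AE \<omega> in M. Y \<omega> \<le> Y' \<omega>" if Y': "\<forall>i\<in>I. AE \<omega> in M. f i \<omega> \<le> Y' \<omega>" for Y'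
  proof -
    have "AE \<omega> in M. \<forall>i\<in>K. f i \<omega> \<le> Y' \<omega>"
      using Y' K by (subst AE_ball_countable) auto
    then show ?thesis by eventually_elim (auto simp: Y_def intro: SUP_least)
  qed
  ultimately show ?thesis using Y unfolding is_ess_Sup_def by blast
qed

lemma is_ess_Inf_uminus:
  assumes "is_ess_Sup M I (\<lambda>i \<omega>. - f i \<omega>) Y"
  shows "is_ess_Inf M I f (\<lambda>\<omega>. - Y \<omega>)"
  unfolding is_ess_Inf_def
proof (intro conjI ballI impI)
  show "(\<lambda>\<omega>. - Y \<omega>) \<in> borel_measurable M" using assms by (simp add: is_ess_Sup_def)
  show "AE \<omega> in M. - Y \<omega> \<le> f i \<omega>" if "i \<in> I" for i
  proof -
    have "AE \<omega> in M. - f i \<omega> \<le> Y \<omega>" using assms that by (simp add: is_ess_Sup_def)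
    then show ?thesis by eventually_elim (simp add: ereal_uminus_le_reorder)
  qed
  fix Y' assume Y': "Y' \<in> borel_measurable M" "\<forall>i\<in>I. AE \<omega> in M. Y' \<omega> \<le> f i \<omega>"
  have "AE \<omega> in M. Y \<omega> \<le> - Y' \<omega>"
    using assms Y' unfolding is_ess_Sup_def by (auto dest!: bspec[of _ _ "\<lambda>\<omega>. - Y' \<omega>"])
  then show "AE \<omega> in M. Y' \<omega> \<le> - Y \<omega>" by eventually_elim (metis ereal_minus_le_minus ereal_uminus_uminus)
qed

lemma (in finite_measure) ess_Inf_exists:
  assumes "\<And>i. i \<in> I \<Longrightarrow> f i \<in> borel_measurable M"
  shows "\<exists>Y. is_ess_Inf M I f Y"
proof -
  have "\<exists>Y. is_ess_Sup M I (\<lambda>i \<omega>. - f i \<omega>) Y"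
    using assms by (intro ess_Sup_exists borel_measurable_uminus_ereal)
  then show ?thesis using is_ess_Inf_uminus by blast
qed

lemma is_ess_Sup_unique: "is_ess_Sup M I f Y \<Longrightarrow> is_ess_Sup M I f Z \<Longrightarrow> AE \<omega> in M. Y \<omega> = Z \<omega>"
proof -
  assume Y: "is_ess_Sup M I f Y" and Z: "is_ess_Sup M I f Z"
  have "AE \<omega> in M. Y \<omega> \<le> Z \<omega>" "AE \<omega> in M. Z \<omega> \<le> Y \<omega>"
    using Y Z unfolding is_ess_Sup_def by blast+
  then show ?thesis by eventually_elim (rule order_antisym)
qed

lemma is_ess_Inf_unique: "is_ess_Inf M I f Y \<Longrightarrow> is_ess_Inf M I f Z \<Longrightarrow> AE \<omega> in M. Y \<omega> = Z \<omega>"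
proof -
  assume Y: "is_ess_Inf M I f Y" and Z: "is_ess_Inf M I f Z"
  have "AE \<omega> in M. Y \<omega> \<le> Z \<omega>" "AE \<omega> in M. Z \<omega> \<le> Y \<omega>"
    using Y Z unfolding is_ess_Inf_def by blast+
  then show ?thesis by eventually_elim (rule order_antisym)
qed

lemma (in finite_measure) is_ess_Sup_ess_Sup:
  assumes "\<And>i. i \<in> I \<Longrightarrow> f i \<in> borel_measurable M"
  shows "is_ess_Sup M I f (ess_Sup M I f)"
  unfolding ess_Sup_def by (rule someI_ex[OF ess_Sup_exists[OF assms]])

lemma (in finite_measure) is_ess_Inf_ess_Inf:
  assumes "\<And>i. i \<in> I \<Longrightarrow> f i \<in> borel_measurable M"
  shows "is_ess_Inf M I f (ess_Inf M I f)"
  unfolding ess_Inf_def by (rule someI_ex[OF ess_Inf_exists[OF assms]])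


section \<open>Extended-real expectations\<close>

text \<open>
  \<open>e2ennreal\<close> maps negative numbers to 0, so \<open>e2ennreal (Y \<omega>)\<close> and \<open>e2ennreal (- Y \<omega>)\<close> are the
  positive and the negative part of \<open>Y \<omega>\<close>.  The definitions below are used for \<open>Y\<close> almost surely
  bounded above only; the first term is then finite and the values lie in \<open>[-\<infinity>, \<infinity>)\<close>.
\<close>

definition ereal_expectation :: "'w measure \<Rightarrow> ('w \<Rightarrow> ereal) \<Rightarrow> ereal" where
  "ereal_expectation M Y =
     enn2ereal (\<integral>\<^sup>+ \<omega>. e2ennreal (Y \<omega>) \<partial>M) - enn2ereal (\<integral>\<^sup>+ \<omega>. e2ennreal (- Y \<omega>) \<partial>M)"

definition ereal_cond_exp :: "'w measure \<Rightarrow> 'w measure \<Rightarrow> ('w \<Rightarrow> ereal) \<Rightarrow> 'w \<Rightarrow> ereal" where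
  "ereal_cond_exp M G Y = (\<lambda>\<omega>.
     enn2ereal (nn_cond_exp M G (\<lambda>\<omega>. e2ennreal (Y \<omega>)) \<omega>)
     - enn2ereal (nn_cond_exp M G (\<lambda>\<omega>. e2ennreal (- Y \<omega>)) \<omega>))"


section \<open>Brownian motion and its completed filtration\<close>

definition natural_filtration :: "'w measure \<Rightarrow> (real \<Rightarrow> 'w \<Rightarrow> real ^ 'd) \<Rightarrow> real \<Rightarrow> 'w measure" where
  "natural_filtration M W t =
     sigma (space M) (\<Union>u\<in>{0..t}. {W u -` B \<inter> space M | B. B \<in> sets borel})"

definition completed_filtration :: "'w measure \<Rightarrow> (real \<Rightarrow> 'w \<Rightarrow> real ^ 'd) \<Rightarrow> real \<Rightarrow> 'w measure" where
  "completed_filtration M W t = sigma (space M) (sets (natural_filtration M W t) \<union> null_sets M)"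

text \<open>
  The increment over \<open>[s, t]\<close> has the centred Gaussian law with covariance \<open>(t - s)\<close> times the
  identity; its product density also encodes the independence of the coordinates.
\<close>

locale brownian_motion = prob_space M
  for M :: "'w measure" and W :: "real \<Rightarrow> 'w \<Rightarrow> real ^ 'd" and T :: real +
  assumes random_variable_W: "0 \<le> t \<Longrightarrow> t \<le> T \<Longrightarrow> W t \<in> borel_measurable M"
    and W_0: "AE \<omega> in M. W 0 \<omega> = 0"
    and continuous_paths: "AE \<omega> in M. continuous_on {0..T} (\<lambda>t. W t \<omega>)"
    and normal_increments: "0 \<le> s \<Longrightarrow> s < t \<Longrightarrow> t \<le> T \<Longrightarrow>
      distributed M lborel (\<lambda>\<omega>. W t \<omega> - W s \<omega>)
        (\<lambda>x. ennreal (\<Prod>i\<in>UNIV. normal_density 0 (sqrt (t - s)) (x $ i)))"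
    and indep_increments: "0 \<le> s \<Longrightarrow> s < t \<Longrightarrow> t \<le> T \<Longrightarrow>
      indep_set (sets (natural_filtration M W s))
        {(\<lambda>\<omega>. W t \<omega> - W s \<omega>) -` B \<inter> space M | B. B \<in> sets borel}"

text \<open>
  Since \<open>M\<close> is complete, its null sets comprise all subsets of null sets, so that the completed
  filtration is complete in the usual sense; the last assumption says that the \<open>\<sigma>\<close>-algebra of
  the probability space is the one generated by the Brownian motion up to \<open>T\<close> and the null sets.
\<close>

locale brownian_space = brownian_motion M W T + complete_measure M
  for M :: "'w measure" and W :: "real \<Rightarrow> 'w \<Rightarrow> real ^ 'd" and T :: real +
  assumes T_pos: "0 < T"
    and sets_eq_terminal: "sets M = sets (completed_filtration M W T)"

definition L0 :: "'w measure \<Rightarrow> ('w \<Rightarrow> real) set" where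
  "L0 G = borel_measurable G"

definition L1_plus :: "'w measure \<Rightarrow> 'w measure \<Rightarrow> ('w \<Rightarrow> real) set" where
  "L1_plus M G = {Z \<in> borel_measurable G. integrable M Z \<and> (AE \<omega> in M. 0 \<le> Z \<omega>)}"

definition Linfty :: "'w measure \<Rightarrow> 'w measure \<Rightarrow> ('w \<Rightarrow> real) set" where
  "Linfty M G = {X \<in> borel_measurable G. \<exists>C. AE \<omega> in M. \<bar>X \<omega>\<bar> \<le> C}"


section \<open>Loss functions and the optimized certainty equivalent\<close>

definition conjugate :: "(real \<Rightarrow> real) \<Rightarrow> real \<Rightarrow> ereal" where
  "conjugate l z = (SUP x. ereal (x * z - l x))"

definition conjugate_dom :: "(real \<Rightarrow> real) \<Rightarrow> real set" where
  "conjugate_dom l = {z. 0 \<le> z \<and> conjugate l z < \<infinity>}"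

locale loss_function =
  fixes l :: "real \<Rightarrow> real"
  assumes convex: "convex_on UNIV l"
    and increasing: "mono l"
    and zero: "l 0 = 0"
    and conjugate_one: "conjugate l 1 = 0"
    and above_identity: "\<exists>K. \<forall>x. K \<le> \<bar>x\<bar> \<longrightarrow> x < l x"

definition OCE :: "'w measure \<Rightarrow> (real \<Rightarrow> real) \<Rightarrow> ('w \<Rightarrow> real) \<Rightarrow> ereal" where
  "OCE M l X = (INF r. ereal ((\<integral>\<omega>. l (X \<omega> - r) \<partial>M) + r))"

definition cond_OCE ::
  "'w measure \<Rightarrow> (real \<Rightarrow> 'w measure) \<Rightarrow> (real \<Rightarrow> real) \<Rightarrow> ('w \<Rightarrow> real) \<Rightarrow> real \<Rightarrow> ('w \<Rightarrow> real) \<Rightarrow> 'w \<Rightarrow> ereal"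
where
  "cond_OCE M F l X s \<eta> =
     ess_Inf M UNIV (\<lambda>r \<omega>. ereal (real_cond_exp M (F s) (\<lambda>\<omega>. l (X \<omega> - r)) \<omega> + r * \<eta> \<omega>))"

definition cond_densities ::
  "'w measure \<Rightarrow> (real \<Rightarrow> 'w measure) \<Rightarrow> (real \<Rightarrow> real) \<Rightarrow> real \<Rightarrow> real \<Rightarrow> ('w \<Rightarrow> real) \<Rightarrow> ('w \<Rightarrow> real) set"
where
  "cond_densities M F l s t \<eta> =
     {Z \<in> L1_plus M (F t).
        (AE \<omega> in M. \<eta> \<omega> * Z \<omega> \<in> conjugate_dom l) \<and>
        (AE \<omega> in M. real_cond_exp M (F s) Z \<omega> = 1)}"

end

theory Submission
  imports Defs
begin

text \<open>
  Let \<open>G \<subseteq> H\<close> be the \<open>\<sigma>\<close>-algebras at times \<open>s \<le> t\<close>.  The inequality \<open>\<ge>\<close> holds because the infimum of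
  an expectation dominates the expectation of the infimum and \<open>E[\<eta> Z | G] = \<eta>\<close>.  For \<open>\<le>\<close>, a density
  \<open>Z = E[Y | H] / \<eta>\<close> is optimal as soon as \<open>Y\<close> is a subgradient of \<open>l\<close> at \<open>X - r\<close> with \<open>E[Y | G] = \<eta>\<close>,
  where \<open>r\<close> is a \<open>G\<close>-measurable minimiser of \<open>E[l(X - r) | G] + r \<eta>\<close>.  To avoid regular versions of
  this random function and measurable selections, \<open>r\<close> is taken on a grid of mesh \<open>h\<close>.  Comparing a
  minimising grid point with its two neighbours shows that \<open>\<eta>\<close> lies between the conditional
  expectations of the two adjacent chord slopes of \<open>l\<close>, so \<open>Y\<close> can be chosen as a \<open>G\<close>-measurable
  convex combination of these slopes; it is a subgradient up to an error \<open>h Y\<close>.  Since the essential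
  supremum only has to be bounded below almost surely, it is enough to do this on each of countably
  many \<open>G\<close>-measurable events, with \<open>Z = 1\<close> off the event.  The last formula is the case of trivial \<open>G\<close>.
\<close>

section \<open>Convex loss functions\<close>

text \<open>The points \<open>x + h\<close> and \<open>y\<close> lie between \<open>x\<close> and
  \<open>y + h\<close> and have the same midpoint as these two. Bounding \<open>f\<close> at both by
  the chord over the whole interval and adding, the slope terms cancel.\<close>

lemma convex_increment_mono:
  fixes f :: "real \<Rightarrow> real"
  assumes f: "convex_on UNIV f" and "x \<le> y" "0 \<le> h"
  shows "f (x + h) - f x \<le> f (y + h) - f y"
proof (cases "h = 0 \<or> x = y")
  case False
  with assms have xy: "x < y" "0 < h" by auto
  have p: "0 < y + h - x" using xy by simp
  have 1: "f (x + h) \<le> (f (y + h) - f x) / (y + h - x) * h + f x"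
    using convex_onD_Icc'[of x "y + h" f "x + h"] convex_on_subset[OF f] xy by auto
  have 2: "f y \<le> (f x - f (y + h)) / (y + h - x) * h + f (y + h)"
    using convex_onD_Icc''[of x "y + h" f y] convex_on_subset[OF f] xy by auto
  have "(f (y + h) - f x) / (y + h - x) * h + (f x - f (y + h)) / (y + h - x) * h = 0"
    by (simp add: diff_divide_distrib algebra_simps)
  with 1 2 show ?thesis by linarith
qed auto

text \<open>The right endpoint is moved first and the left one afterwards. In this order the
  intermediate interval from \<open>x\<close> to \<open>y'\<close> is nondegenerate, while in the
  other order \<open>x'\<close> might overtake \<open>y\<close>.\<close>

lemma convex_slope_mono:
  fixes f :: "real \<Rightarrow> real"
  assumes f: "convex_on UNIV f" and "x < y" "x' < y'" "x \<le> x'" "y \<le> y'"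
  shows "(f y - f x) / (y - x) \<le> (f y' - f x') / (y' - x')"
proof -
  have "(f y - f x) / (y - x) \<le> (f y' - f x) / (y' - x)"
  proof (cases "y = y'")
    case False
    have "(f x - f y) / (x - y) \<le> (f x - f y') / (x - y')"
      using convex_on_slope_le(1)[OF f, of x y' y] assms False by auto
    then show ?thesis by (metis minus_diff_eq minus_divide_divide)
  qed simp
  also have "\<dots> \<le> (f y' - f x') / (y' - x')"
  proof (cases "x = x'")
    case False
    have "(f x - f y') / (x - y') \<le> (f x' - f y') / (x' - y')"
      using convex_on_slope_le(2)[OF f, of x y' x'] assms False by auto
    then show ?thesis by (metis minus_diff_eq minus_divide_divide)
  qed simp
  finally show ?thesis .
qed

text \<open>A minimiser over the finite window from \<open>min k0 k1\<close> to
  \<open>max k0 k1\<close> works: only at the ends of the window does a neighbour fall outside, and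
  there \<open>up\<close> or \<open>down\<close> supplies the comparison.\<close>

lemma int_local_min_exists:
  fixes g :: "int \<Rightarrow> real"
  assumes up: "\<And>k. k0 \<le> k \<Longrightarrow> g k \<le> g (k + 1)" and down: "\<And>k. k \<le> k1 \<Longrightarrow> g k \<le> g (k - 1)"
  shows "\<exists>k. g k \<le> g (k + 1) \<and> g k \<le> g (k - 1)"
proof -
  define a b where "a = min k0 k1" and "b = max k0 k1"
  have ne: "finite {a..b}" "{a..b} \<noteq> {}" by (auto simp: a_def b_def)
  obtain k where k: "k \<in> {a..b}" "\<And>j. j \<in> {a..b} \<Longrightarrow> g k \<le> g j"
    using ex_is_arg_min_if_finite[OF ne, of g] by (auto simp: is_arg_min_linorder)
  have "g k \<le> g (k + 1)"
    by (cases "k = b") (use k up[of k] in \<open>auto simp: b_def\<close>)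
  moreover have "g k \<le> g (k - 1)"
    by (cases "k = a") (use k down[of k] in \<open>auto simp: a_def\<close>)
  ultimately show ?thesis by blast
qed

section \<open>The domain of the conjugate in terms of real bounds\<close>

lemma in_conjugate_domI:
  assumes "0 \<le> z" "\<And>y. y * z - l y \<le> B"
  shows "z \<in> conjugate_dom l"
proof -
  have "conjugate l z \<le> ereal B" unfolding conjugate_def using assms(2) by (intro SUP_least) auto
  also have "\<dots> < \<infinity>" by simp
  finally show ?thesis using assms(1) by (simp add: conjugate_dom_def)
qed

lemma conjugate_domE:
  assumes "z \<in> conjugate_dom l"
  obtains B where "0 \<le> z" "\<And>y. y * z - l y \<le> B"
proof -
  have *: "ereal (y * z - l y) \<le> conjugate l z" for y
    unfolding conjugate_def by (rule SUP_upper) simp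
  have "conjugate l z < \<infinity>" using assms by (simp add: conjugate_dom_def)
  then obtain B where "conjugate l z = ereal B"
    using *[of 0] by (cases "conjugate l z") auto
  with * have "y * z - l y \<le> B" for y by simp
  moreover have "0 \<le> z" using assms by (simp add: conjugate_dom_def)
  ultimately show ?thesis using that by blast
qed

section \<open>Approximate subgradients and near-minimisers of the loss\<close>

context loss_function
begin

lemma continuous: "continuous_on UNIV l"
  by (rule convex_on_continuous[OF open_UNIV convex])

lemma borel_measurable_l [measurable]: "l \<in> borel_measurable borel"
  by (rule borel_measurable_continuous_onI[OF continuous])

lemma one_in_conjugate_dom: "1 \<in> conjugate_dom l"
  using conjugate_one by (simp add: conjugate_dom_def)

text \<open>The correction \<open>- h\<close> makes a chord slope an approximate subgradient at
  \<open>x\<close>. Outside the interval from \<open>x\<close> to \<open>x + h\<close>, slope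
  comparison gives the bound even without the correction; inside it, \<open>y - x - h\<close> is
  nonpositive and monotonicity of \<open>l\<close> suffices.\<close>

lemma chord_support_right:
  assumes h: "0 < h"
  shows "l x + (y - x - h) * ((l (x + h) - l x) / h) \<le> l y"
proof -
  define d where "d = (l (x + h) - l x) / h"
  have d0: "0 \<le> d" using increasing h by (auto simp: d_def mono_def)
  consider "y < x" | "x \<le> y" "y \<le> x + h" | "x + h < y" by linarith
  then have "l x + (y - x - h) * d \<le> l y"
  proof cases
    case 1
    have "(l x - l y) / (x - y) \<le> d"
      using convex_slope_mono[OF convex, of y x x "x + h"] 1 h by (simp add: d_def)
    then have "l x - l y \<le> d * (x - y)" using 1 by (simp add: divide_le_eq)
    moreover have "0 \<le> d * h" using d0 h by simp
    ultimately show ?thesis by (simp add: algebra_simps)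
  next
    case 2
    have "l x \<le> l y" using increasing 2 by (auto simp: mono_def)
    moreover have "(y - x - h) * d \<le> 0" using 2 d0 by (simp add: mult_nonpos_nonneg)
    ultimately show ?thesis by simp
  next
    case 3
    have "d \<le> (l y - l x) / (y - x)"
      using convex_slope_mono[OF convex, of x "x + h" x y] 3 h by (simp add: d_def)
    then have "d * (y - x) \<le> l y - l x" using 3 h by (simp add: le_divide_eq)
    moreover have "0 \<le> d * h" using d0 h by simp
    ultimately show ?thesis by (simp add: algebra_simps)
  qed
  then show ?thesis by (simp add: d_def)
qed

text \<open>This is the bound for the right chord based at \<open>x - h\<close>: replacing
  \<open>l (x - h)\<close> by \<open>l x\<close> costs the rise of the chord over length
  \<open>h\<close>, which produces the same correction.\<close>

lemma chord_support_left:
  assumes h: "0 < h"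
  shows "l x + (y - x - h) * ((l x - l (x - h)) / h) \<le> l y"
proof -
  define d where "d = (l x - l (x - h)) / h"
  have d0: "0 \<le> d" using increasing h by (auto simp: d_def mono_def)
  have "l (x - h) + (y - (x - h) - h) * d \<le> l y"
    using chord_support_right[OF h, of "x - h" y] by (simp add: d_def)
  moreover have "l x = l (x - h) + h * d" using h by (simp add: d_def)
  ultimately show ?thesis using d0 h unfolding d_def[symmetric] by (simp add: algebra_simps)
qed

text \<open>The objective \<open>l (x - r) + r * z\<close> equals \<open>g (x - r) + z * x\<close>
  with \<open>g y = l y - z * y\<close>, which is bounded below. For monotone \<open>g\<close>, a
  near-minimiser \<open>y0\<close> bounds \<open>g\<close> on a whole ray, and one shift moves all
  \<open>x\<close> in the bounded range into that ray. The shift is an integer so that only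
  countably many cases arise later.\<close>

lemma boundary_slope_near_min:
  assumes z: "z \<in> conjugate_dom l" and e: "0 < e"
    and flat: "mono (\<lambda>y. l y - z * y) \<or> antimono (\<lambda>y. l y - z * y)"
  shows "\<exists>k::int. \<forall>x. \<bar>x\<bar> \<le> C \<longrightarrow> (\<forall>r. l (x - k) + k * z - e \<le> l (x - r) + r * z)"
proof -
  define g where "g y = l y - z * y" for y
  obtain B where B: "\<And>y. y * z - l y \<le> B" using conjugate_domE[OF z] by metis
  have bdd: "bdd_below (range g)"
    using B by (intro bdd_belowI[of _ "- B"]) (auto simp: g_def algebra_simps minus_le_iff)
  have "Inf (range g) < Inf (range g) + e" using e by simp
  then obtain y0 where y0: "g y0 < Inf (range g) + e"
    using cInf_lessD[of "range g" "Inf (range g) + e"] by auto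
  have near: "g y0 - e \<le> g y" for y
    using y0 cInf_lower[OF rangeI bdd, of y] by simp
  have "\<exists>k::int. \<forall>x. \<bar>x\<bar> \<le> C \<longrightarrow> g (x - k) \<le> g y0"
    using flat
  proof
    assume "mono (\<lambda>y. l y - z * y)"
    \<comment> \<open>Rounding up ensures \<open>x - k \<le> y0\<close> for all
      \<open>x \<le> C\<close>. In the decreasing case below, rounding down ensures
      \<open>y0 \<le> x - k\<close> for all \<open>x \<ge> - C\<close>.\<close>
    then have "g (x - \<lceil>C - y0\<rceil>) \<le> g y0" if "\<bar>x\<bar> \<le> C" for x
      using that unfolding g_def[symmetric] by (intro monoD[of g]) (linarith | assumption)+
    then show ?thesis by blast
  next
    assume "antimono (\<lambda>y. l y - z * y)"
    then have "g (x - \<lfloor>- C - y0\<rfloor>) \<le> g y0" if "\<bar>x\<bar> \<le> C" for x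
      using that unfolding g_def[symmetric] by (intro antimonoD[of g]) (linarith | assumption)+
    then show ?thesis by blast
  qed
  then obtain k :: int where k: "\<And>x. \<bar>x\<bar> \<le> C \<Longrightarrow> g (x - k) \<le> g y0" by blast
  have "l (x - k) + k * z - e \<le> l (x - r) + r * z" if "\<bar>x\<bar> \<le> C" for x r :: real
    using k[OF that] near[of "x - r"] by (simp add: g_def algebra_simps)
  then show ?thesis by blast
qed

text \<open>Failure of monotonicity provides a chord of slope below \<open>z\<close>. For large
  \<open>k\<close> the grid interval lies to the left of this chord, so its slope is no larger. This
  makes the grid objective nondecreasing in \<open>k\<close> for large \<open>k\<close>.\<close>

lemma increments_below_eventually:
  assumes "\<not> mono (\<lambda>y. l y - z * y)" "0 < h"
  shows "\<exists>k0::int. \<forall>k\<in>{k0..}. l (C - real_of_int k * h) - l (C - real_of_int k * h - h) \<le> h * z"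
proof -
  obtain x y where "x \<le> y" "l y - z * y < l x - z * x"
    using assms(1) by (auto simp: mono_def not_le)
  then have xy: "x < y" "l y - l x < z * (y - x)"
    by (cases "x = y", auto simp: right_diff_distrib)+
  have "l (C - k * h) - l (C - k * h - h) \<le> h * z" if "\<lceil>(C - x) / h\<rceil> \<le> k" for k :: int
  proof -
    have "C - x \<le> k * h" using that assms(2) by (simp add: ceiling_le_iff pos_divide_le_eq)
    then have "(l (C - k * h) - l (C - k * h - h)) / h \<le> (l y - l x) / (y - x)"
      using convex_slope_mono[OF convex, of "C - k * h - h" "C - k * h" x y] assms(2) xy by simp
    also have "\<dots> \<le> z" using xy by (simp add: pos_divide_le_eq)
    finally show ?thesis using assms(2) by (simp add: pos_divide_le_eq mult.commute)
  qed
  then show ?thesis by blast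
qed

text \<open>The mirror image: some chord has slope above \<open>z\<close>, and for sufficiently
  small \<open>k\<close> the grid interval lies to its right.\<close>

lemma increments_above_eventually:
  assumes "\<not> antimono (\<lambda>y. l y - z * y)" "0 < h"
  shows "\<exists>k1::int. \<forall>k\<in>{..k1}. h * z \<le> l (C - real_of_int k * h + h) - l (C - real_of_int k * h)"
proof -
  obtain x y where "x \<le> y" "l x - z * x < l y - z * y"
    using assms(1) by (auto simp: antimono_def not_le)
  then have xy: "x < y" "z * (y - x) < l y - l x"
    by (cases "x = y", auto simp: right_diff_distrib)+
  have "h * z \<le> l (C - k * h + h) - l (C - k * h)" if "k \<le> \<lfloor>(C - y) / h\<rfloor>" for k :: int
  proof -
    have "k * h \<le> C - y" using that assms(2) by (simp add: le_floor_iff pos_le_divide_eq)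
    then have "(l y - l x) / (y - x) \<le> (l (C - k * h + h) - l (C - k * h)) / h"
      using convex_slope_mono[OF convex, of x y "C - k * h" "C - k * h + h"] assms(2) xy by simp
    moreover have "z \<le> (l y - l x) / (y - x)" using xy by (simp add: pos_le_divide_eq)
    ultimately have "z \<le> (l (C - k * h + h) - l (C - k * h)) / h" by simp
    then show ?thesis using assms(2) by (simp add: pos_le_divide_eq mult.commute)
  qed
  then show ?thesis by blast
qed

text \<open>Continuity of \<open>l\<close> lets rational points decide the bound, so that almost
  sure inequalities for individual points can be collected into one null set.\<close>

lemma rational_conjugate_bound:
  assumes "\<And>q. of_rat q * z - l (of_rat q) \<le> B"
  shows "y * z - l y \<le> B"
proof -
  have "closed {y. y * z - l y \<le> B}"
    by (intro closed_Collect_le continuous_intros continuous)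
  moreover have "\<rat> \<subseteq> {y. y * z - l y \<le> B}" using assms by (auto simp: Rats_def)
  ultimately have "closure \<rat> \<subseteq> {y. y * z - l y \<le> B}" by (rule closure_minimal[rotated])
  then show ?thesis by (auto simp: Rats_closure_real)
qed

end

section \<open>Conditional expectations of extended real random variables\<close>

context finite_measure_subalgebra
begin

text \<open>Localisation: the indicator of \<open>A\<close> is measurable for the conditioning
  \<sigma>-algebra, so it can be multiplied in before comparing and pulled out afterwards.\<close>

lemma nn_cond_exp_mono_on:
  assumes A: "A \<in> sets F" and [measurable]: "f \<in> borel_measurable M" "g \<in> borel_measurable M"
    and le: "AE \<omega> in M. \<omega> \<in> A \<longrightarrow> f \<omega> \<le> g \<omega>"
  shows "AE \<omega> in M. \<omega> \<in> A \<longrightarrow> nn_cond_exp M F f \<omega> \<le> nn_cond_exp M F g \<omega>"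
proof -
  have [measurable]: "A \<in> sets M" using A subalg by (auto simp: subalgebra_def)
  have ind: "(indicator A :: 'a \<Rightarrow> ennreal) \<in> borel_measurable F"
    using A by (rule borel_measurable_indicator)
  have "AE \<omega> in M. nn_cond_exp M F (\<lambda>\<omega>. indicator A \<omega> * f \<omega>) \<omega>
                 \<le> nn_cond_exp M F (\<lambda>\<omega>. indicator A \<omega> * g \<omega>) \<omega>"
    using le by (intro nn_cond_exp_mono) (auto simp: indicator_def elim!: eventually_mono)
  then show ?thesis
    using nn_cond_exp_prod[OF ind, of f] nn_cond_exp_prod[OF ind, of g]
    by (auto elim!: eventually_elim2 simp: indicator_def)
qed

lemma real_cond_exp_mono_on:
  assumes A: "A \<in> sets F" and int [measurable]: "integrable M f" "integrable M g"
    and le: "AE \<omega> in M. \<omega> \<in> A \<longrightarrow> f \<omega> \<le> g \<omega>"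
  shows "AE \<omega> in M. \<omega> \<in> A \<longrightarrow> real_cond_exp M F f \<omega> \<le> real_cond_exp M F g \<omega>"
proof -
  have [measurable]: "A \<in> sets M" using A subalg by (auto simp: subalgebra_def)
  have ind: "(indicator A :: 'a \<Rightarrow> real) \<in> borel_measurable F"
    using A by (rule borel_measurable_indicator)
  have int': "integrable M (\<lambda>\<omega>. indicator A \<omega> * f \<omega>)" "integrable M (\<lambda>\<omega>. indicator A \<omega> * g \<omega>)"
    using integrable_mult_indicator[OF \<open>A \<in> sets M\<close> int(1)]
      integrable_mult_indicator[OF \<open>A \<in> sets M\<close> int(2)] by simp_all
  have "AE \<omega> in M. real_cond_exp M F (\<lambda>\<omega>. indicator A \<omega> * f \<omega>) \<omega>
                 \<le> real_cond_exp M F (\<lambda>\<omega>. indicator A \<omega> * g \<omega>) \<omega>"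
    using le by (intro real_cond_exp_mono int') (auto simp: indicator_def elim!: eventually_mono)
  moreover have "AE \<omega> in M. real_cond_exp M F (\<lambda>\<omega>. indicator A \<omega> * f \<omega>) \<omega> = indicator A \<omega> * real_cond_exp M F f \<omega>"
    "AE \<omega> in M. real_cond_exp M F (\<lambda>\<omega>. indicator A \<omega> * g \<omega>) \<omega> = indicator A \<omega> * real_cond_exp M F g \<omega>"
    by (intro real_cond_exp_mult ind int' borel_measurable_integrable int)+
  ultimately show ?thesis by eventually_elim (auto simp: indicator_def)
qed

lemma borel_measurable_ereal_cond_exp [measurable]: "ereal_cond_exp M F Y \<in> borel_measurable M"
  unfolding ereal_cond_exp_def by measurable

lemma ereal_cond_exp_mono_on:
  assumes A: "A \<in> sets F" and [measurable]: "Y \<in> borel_measurable M" "Y' \<in> borel_measurable M"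
    and le: "AE \<omega> in M. \<omega> \<in> A \<longrightarrow> Y \<omega> \<le> Y' \<omega>"
  shows "AE \<omega> in M. \<omega> \<in> A \<longrightarrow> ereal_cond_exp M F Y \<omega> \<le> ereal_cond_exp M F Y' \<omega>"
proof -
  have "AE \<omega> in M. \<omega> \<in> A \<longrightarrow> nn_cond_exp M F (\<lambda>\<omega>. e2ennreal (Y \<omega>)) \<omega> \<le> nn_cond_exp M F (\<lambda>\<omega>. e2ennreal (Y' \<omega>)) \<omega>"
    "AE \<omega> in M. \<omega> \<in> A \<longrightarrow> nn_cond_exp M F (\<lambda>\<omega>. e2ennreal (- Y' \<omega>)) \<omega> \<le> nn_cond_exp M F (\<lambda>\<omega>. e2ennreal (- Y \<omega>)) \<omega>"
    using le by (intro nn_cond_exp_mono_on A; auto intro!: e2ennreal_mono elim!: eventually_mono)+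
  then show ?thesis
    by eventually_elim (auto simp: ereal_cond_exp_def less_eq_ennreal.rep_eq intro!: ereal_minus_mono)
qed

text \<open>Integrability makes the conditional expectations of the positive and the negative part
  finite almost surely, and there the extended difference is the real one.\<close>

lemma ereal_cond_exp_ereal:
  assumes f: "integrable M f"
  shows "AE \<omega> in M. ereal_cond_exp M F (\<lambda>\<omega>. ereal (f \<omega>)) \<omega> = ereal (real_cond_exp M F f \<omega>)"
proof -
  have fin: "AE \<omega> in M. nn_cond_exp M F (\<lambda>\<omega>. ennreal (g \<omega>)) \<omega> < \<infinity>" if g: "integrable M g" for g
  proof -
    have [measurable]: "g \<in> borel_measurable M" using g by simp
    have "(\<integral>\<^sup>+ \<omega>. nn_cond_exp M F (\<lambda>\<omega>. ennreal (g \<omega>)) \<omega> \<partial>M) = (\<integral>\<^sup>+ \<omega>. ennreal (g \<omega>) \<partial>M)"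
      using nn_cond_exp_intg[of "\<lambda>_. 1" "\<lambda>\<omega>. ennreal (g \<omega>)"] by simp
    also have "\<dots> \<le> (\<integral>\<^sup>+ \<omega>. ennreal (norm (g \<omega>)) \<partial>M)"
      by (intro nn_integral_mono ennreal_leI) auto
    also have "\<dots> < \<infinity>" using g by (simp add: integrable_iff_bounded)
    finally show ?thesis using nn_integral_PInf_AE[of "nn_cond_exp M F (\<lambda>\<omega>. ennreal (g \<omega>))" M]
      by (auto simp: less_top)
  qed
  have e: "e2ennreal (ereal x) = ennreal x" for x
    by (cases "0 \<le> x") (auto simp: ennreal_def e2ennreal_def max_def e2ennreal_neg)
  have e2: "enn2ereal x = ereal (enn2real x)" if "x < \<infinity>" for x
    using that by (cases x) (auto simp: enn2ereal_ennreal)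
  have "integrable M (\<lambda>\<omega>. - f \<omega>)" using f by simp
  from fin[OF f] fin[OF this] show ?thesis
    by eventually_elim (simp add: ereal_cond_exp_def real_cond_exp_def e e2)
qed

end

section \<open>The dynamic dual representation\<close>

lemma (in finite_measure) integrable_bounded_mult:
  fixes f g :: "'a \<Rightarrow> real"
  assumes "integrable M g" "f \<in> borel_measurable M" "AE \<omega> in M. \<bar>f \<omega>\<bar> \<le> B"
  shows "integrable M (\<lambda>\<omega>. f \<omega> * g \<omega>)"
proof (rule Bochner_Integration.integrable_bound)
  show "integrable M (\<lambda>\<omega>. B * g \<omega>)" using assms by simp
  show "(\<lambda>\<omega>. f \<omega> * g \<omega>) \<in> borel_measurable M" using assms by simp
  show "AE \<omega> in M. norm (f \<omega> * g \<omega>) \<le> norm (B * g \<omega>)"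
    using assms(3) by eventually_elim (auto simp: abs_mult intro: mult_right_mono)
qed

text \<open>The time points are replaced by nested \<sigma>-algebras \<open>G\<close> and
  \<open>H\<close>. This covers the filtration at two times as well as the trivial \<open>G\<close>
  that turns conditional values into numbers.\<close>

locale nested_loss = prob_space M + loss_function l
  for M :: "'w measure" and l :: "real \<Rightarrow> real" +
  fixes G H :: "'w measure" and X \<eta> :: "'w \<Rightarrow> real" and C :: real
  assumes MH: "subalgebra M H" and HG: "subalgebra H G"
    and X [measurable]: "X \<in> borel_measurable M" and X_bounded: "AE \<omega> in M. \<bar>X \<omega>\<bar> \<le> C"
    and \<eta>_G: "\<eta> \<in> borel_measurable G" and \<eta>_dom: "AE \<omega> in M. \<eta> \<omega> \<in> conjugate_dom l"
begin

lemma MG: "subalgebra M G"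
  using MH HG by (auto simp: subalgebra_def)

sublocale H: finite_measure_subalgebra M H
  by unfold_locales (rule MH)

sublocale G: finite_measure_subalgebra M G
  by unfold_locales (rule MG)

lemma \<eta>_M [measurable]: "\<eta> \<in> borel_measurable M"
  by (rule measurable_from_subalg[OF MG \<eta>_G])

lemma \<eta>_nonneg: "AE \<omega> in M. 0 \<le> \<eta> \<omega>"
  using \<eta>_dom by eventually_elim (simp add: conjugate_dom_def)

text \<open>This is \<open>cond_OCE\<close> at \<open>\<eta>\<close>, with \<open>G\<close> in the
  role of the \<sigma>-algebra at the earlier time; \<open>value_H Z\<close> is its counterpart at
  \<open>\<eta> * Z\<close> and the later time.\<close>

definition value_G :: "'w \<Rightarrow> ereal" where
  "value_G = ess_Inf M UNIV (\<lambda>r \<omega>. ereal (real_cond_exp M G (\<lambda>\<omega>. l (X \<omega> - r)) \<omega> + r * \<eta> \<omega>))"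

definition value_H :: "('w \<Rightarrow> real) \<Rightarrow> 'w \<Rightarrow> ereal" where
  "value_H Z = ess_Inf M UNIV (\<lambda>r \<omega>. ereal (real_cond_exp M H (\<lambda>\<omega>. l (X \<omega> - r)) \<omega> + r * (\<eta> \<omega> * Z \<omega>)))"

definition densities :: "('w \<Rightarrow> real) set" where
  "densities = {Z \<in> L1_plus M H. (AE \<omega> in M. \<eta> \<omega> * Z \<omega> \<in> conjugate_dom l) \<and>
                                (AE \<omega> in M. real_cond_exp M G Z \<omega> = 1)}"

section \<open>Integrability of the loss and measurability of the value processes\<close>

lemma loss_bounded: "\<exists>B. AE \<omega> in M. \<bar>l (X \<omega> - r)\<bar> \<le> B"
proof -
  have "AE \<omega> in M. \<bar>l (X \<omega> - r)\<bar> \<le> \<bar>l (C - r)\<bar> + \<bar>l (- C - r)\<bar>"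
    using X_bounded
  proof eventually_elim
    case (elim \<omega>)
    have "l (X \<omega> - r) \<le> l (C - r)" "l (- C - r) \<le> l (X \<omega> - r)"
      using elim by (auto intro!: monoD[OF increasing])
    then show ?case by linarith
  qed
  then show ?thesis by blast
qed

lemma integrable_loss [simp]: "integrable M (\<lambda>\<omega>. l (X \<omega> - r))"
proof -
  obtain B where "AE \<omega> in M. \<bar>l (X \<omega> - r)\<bar> \<le> B" using loss_bounded by blast
  then show ?thesis by (intro integrable_const_bound[of _ B]) auto
qed

lemma value_G_is_ess_Inf:
  "is_ess_Inf M UNIV (\<lambda>r \<omega>. ereal (real_cond_exp M G (\<lambda>\<omega>. l (X \<omega> - r)) \<omega> + r * \<eta> \<omega>)) value_G"
  unfolding value_G_def by (rule is_ess_Inf_ess_Inf) measurable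

lemma densitiesD:
  assumes "Z \<in> densities"
  shows "Z \<in> borel_measurable M" "integrable M Z" "AE \<omega> in M. 0 \<le> Z \<omega>"
    "AE \<omega> in M. real_cond_exp M G Z \<omega> = 1"
  using assms by (auto simp: densities_def L1_plus_def)

lemma value_H_is_ess_Inf:
  assumes "Z \<in> densities"
  shows "is_ess_Inf M UNIV (\<lambda>r \<omega>. ereal (real_cond_exp M H (\<lambda>\<omega>. l (X \<omega> - r)) \<omega> + r * (\<eta> \<omega> * Z \<omega>))) (value_H Z)"
proof -
  note densitiesD(1)[OF assms, measurable]
  show ?thesis unfolding value_H_def by (rule is_ess_Inf_ess_Inf) measurable
qed

lemma measurable_value_H: "Z \<in> densities \<Longrightarrow> value_H Z \<in> borel_measurable M"
  using value_H_is_ess_Inf by (simp add: is_ess_Inf_def)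

text \<open>Each fixed \<open>r\<close> gives an upper bound for \<open>value_H Z\<close>;
  conditioning it on \<open>G\<close> uses the tower property and the normalisation of
  \<open>Z\<close>. The essential infimum over \<open>r\<close> is taken only at the end.\<close>

lemma cond_exp_value_H_le:
  assumes Z: "Z \<in> densities"
  shows "AE \<omega> in M. ereal_cond_exp M G (value_H Z) \<omega> \<le> value_G \<omega>"
proof -
  note [measurable] = densitiesD(1)[OF Z] measurable_value_H[OF Z]
  have "AE \<omega> in M. ereal_cond_exp M G (value_H Z) \<omega>
      \<le> ereal (real_cond_exp M G (\<lambda>\<omega>. l (X \<omega> - r)) \<omega> + r * \<eta> \<omega>)" for r
  proof -
    \<comment> \<open>The product \<open>\<eta> * Z\<close> is not known to be integrable. On the
      \<open>G\<close>-measurable events \<open>A m\<close> the factor \<open>\<eta>\<close> is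
      bounded and can be pulled out of the conditional expectation; these events exhaust the
      space.\<close>
    define A where "A m = {\<omega>\<in>space M. \<bar>\<eta> \<omega>\<bar> \<le> real m}" for m :: nat
    have A: "A m \<in> sets G" for m
    proof -
      have "A m = \<eta> -` {- real m..real m} \<inter> space G"
        using MG by (auto simp: A_def subalgebra_def)
      then show ?thesis using measurable_sets[OF \<eta>_G, of "{- real m..real m}"] by simp
    qed
    have on_A: "AE \<omega> in M. \<omega> \<in> A m \<longrightarrow> ereal_cond_exp M G (value_H Z) \<omega>
        \<le> ereal (real_cond_exp M G (\<lambda>\<omega>. l (X \<omega> - r)) \<omega> + r * \<eta> \<omega>)" for m
    proof -
      have [measurable]: "A m \<in> sets M" using A MG by (auto simp: subalgebra_def)
      define c where "c \<omega> = indicator (A m) \<omega> * \<eta> \<omega> * r" for \<omega>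
      have c: "c \<in> borel_measurable G" unfolding c_def using A \<eta>_G by measurable
      have [measurable]: "c \<in> borel_measurable M" by (rule measurable_from_subalg[OF MG c])
      have cZ: "integrable M (\<lambda>\<omega>. c \<omega> * Z \<omega>)"
        using densitiesD(2)[OF Z]
        by (rule integrable_bounded_mult[where B="real m * \<bar>r\<bar>"])
           (auto simp: c_def A_def indicator_def abs_mult intro!: AE_I2 mult_right_mono)
      define E where "E = real_cond_exp M H (\<lambda>\<omega>. l (X \<omega> - r))"
      have E: "integrable M E" unfolding E_def by (rule H.real_cond_exp_int) simp
      have "AE \<omega> in M. value_H Z \<omega> \<le> ereal (E \<omega> + r * (\<eta> \<omega> * Z \<omega>))"
        using value_H_is_ess_Inf[OF Z] by (simp add: is_ess_Inf_def E_def)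
      then have "AE \<omega> in M. \<omega> \<in> A m \<longrightarrow> value_H Z \<omega> \<le> ereal (E \<omega> + c \<omega> * Z \<omega>)"
        by eventually_elim (auto simp: c_def indicator_def mult_ac)
      then have "AE \<omega> in M. \<omega> \<in> A m \<longrightarrow> ereal_cond_exp M G (value_H Z) \<omega>
          \<le> ereal_cond_exp M G (\<lambda>\<omega>. ereal (E \<omega> + c \<omega> * Z \<omega>)) \<omega>"
        using E by (intro G.ereal_cond_exp_mono_on A) auto
      moreover have "AE \<omega> in M. ereal_cond_exp M G (\<lambda>\<omega>. ereal (E \<omega> + c \<omega> * Z \<omega>)) \<omega>
          = ereal (real_cond_exp M G (\<lambda>\<omega>. E \<omega> + c \<omega> * Z \<omega>) \<omega>)"
        using E cZ by (intro G.ereal_cond_exp_ereal) simp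
      moreover have "AE \<omega> in M. real_cond_exp M G (\<lambda>\<omega>. E \<omega> + c \<omega> * Z \<omega>) \<omega>
          = real_cond_exp M G E \<omega> + real_cond_exp M G (\<lambda>\<omega>. c \<omega> * Z \<omega>) \<omega>"
        using E cZ by (rule G.real_cond_exp_add)
      moreover have "AE \<omega> in M. real_cond_exp M G E \<omega> = real_cond_exp M G (\<lambda>\<omega>. l (X \<omega> - r)) \<omega>"
        unfolding E_def using MH HG by (rule G.real_cond_exp_nested_subalg) simp
      moreover have "AE \<omega> in M. real_cond_exp M G (\<lambda>\<omega>. c \<omega> * Z \<omega>) \<omega> = c \<omega> * real_cond_exp M G Z \<omega>"
        by (rule G.real_cond_exp_mult[OF c _ cZ]) simp
      ultimately show ?thesis using densitiesD(4)[OF Z]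
        by eventually_elim (auto simp: c_def indicator_def mult_ac)
    qed
    have "AE \<omega> in M. \<forall>m. \<omega> \<in> A m \<longrightarrow> ereal_cond_exp M G (value_H Z) \<omega>
        \<le> ereal (real_cond_exp M G (\<lambda>\<omega>. l (X \<omega> - r)) \<omega> + r * \<eta> \<omega>)"
      unfolding AE_all_countable by (intro allI on_A)
    then show ?thesis using AE_space
    proof eventually_elim
      case (elim \<omega>)
      obtain m :: nat where "\<bar>\<eta> \<omega>\<bar> \<le> real m" using real_arch_simple by blast
      with elim show ?case by (auto simp: A_def)
    qed
  qed
  then show ?thesis
    using value_G_is_ess_Inf by (auto simp: is_ess_Inf_def)
qed

section \<open>The reverse inequality from approximate subgradients\<close>

text \<open>
  The hypothesis \<open>near\<close> says that, up to the error \<open>e * (1 + Y)\<close>, the slope \<open>Y\<close> is a subgradient of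
  \<open>l\<close> at \<open>X - r\<close>.
\<close>

lemma value_G_le_cond_exp_value_H:
  assumes Z: "Z \<in> densities" and A: "A \<in> sets G" and Y: "integrable M Y"
    and YH: "AE \<omega> in M. \<omega> \<in> A \<longrightarrow> real_cond_exp M H Y \<omega> = \<eta> \<omega> * Z \<omega>"
    and YG: "AE \<omega> in M. \<omega> \<in> A \<longrightarrow> real_cond_exp M G Y \<omega> = \<eta> \<omega>"
    and near: "AE \<omega> in M. \<omega> \<in> A \<longrightarrow>
      (\<forall>r'. l (X \<omega> - r) + r * Y \<omega> - e * (1 + Y \<omega>) \<le> l (X \<omega> - r') + r' * Y \<omega>)"
  shows "AE \<omega> in M. \<omega> \<in> A \<longrightarrow> value_G \<omega> \<le> ereal_cond_exp M G (value_H Z) \<omega> + ereal (e * (1 + \<eta> \<omega>))"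
proof -
  note [measurable] = densitiesD(1)[OF Z] measurable_value_H[OF Z] borel_measurable_integrable[OF Y]
  have AH: "A \<in> sets H" using A HG by (auto simp: subalgebra_def)
  have [measurable]: "A \<in> sets M" using A MG by (auto simp: subalgebra_def)
  define S where "S \<omega> = l (X \<omega> - r) + ((r - e) * Y \<omega> + - e)" for \<omega>
  have S: "integrable M S" unfolding S_def using Y by simp
  \<comment> \<open>Maximality of an essential infimum applies to lower bounds on the whole space.
    The value \<open>-\<infinity>\<close> off \<open>A\<close> makes the bound hold there
    trivially.\<close>
  define Y' where "Y' \<omega> = (if \<omega> \<in> A then ereal (real_cond_exp M H S \<omega>) else -\<infinity>)" for \<omega>
  have [measurable]: "Y' \<in> borel_measurable M" unfolding Y'_def by measurable
  have "AE \<omega> in M. Y' \<omega> \<le> ereal (real_cond_exp M H (\<lambda>\<omega>. l (X \<omega> - r')) \<omega> + r' * (\<eta> \<omega> * Z \<omega>))" for r'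
  proof -
    have "AE \<omega> in M. \<omega> \<in> A \<longrightarrow>
        real_cond_exp M H S \<omega> \<le> real_cond_exp M H (\<lambda>\<omega>. l (X \<omega> - r') + r' * Y \<omega>) \<omega>"
    proof (intro H.real_cond_exp_mono_on AH S)
      show "AE \<omega> in M. \<omega> \<in> A \<longrightarrow> S \<omega> \<le> l (X \<omega> - r') + r' * Y \<omega>"
        using near
      proof eventually_elim
        case (elim \<omega>)
        have "l (X \<omega> - r) + r * Y \<omega> - e * (1 + Y \<omega>) \<le> l (X \<omega> - r') + r' * Y \<omega>" if "\<omega> \<in> A"
          using elim[rule_format, OF that] .
        then show ?case by (auto simp: S_def algebra_simps)
      qed
    qed (use Y in simp)
    moreover have "AE \<omega> in M. real_cond_exp M H (\<lambda>\<omega>. l (X \<omega> - r') + r' * Y \<omega>) \<omega>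
        = real_cond_exp M H (\<lambda>\<omega>. l (X \<omega> - r')) \<omega> + real_cond_exp M H (\<lambda>\<omega>. r' * Y \<omega>) \<omega>"
      using Y by (intro H.real_cond_exp_add) auto
    ultimately show ?thesis using YH H.real_cond_exp_cmult[OF Y, of r']
      by eventually_elim (auto simp: Y'_def)
  qed
  then have "AE \<omega> in M. Y' \<omega> \<le> value_H Z \<omega>"
    using value_H_is_ess_Inf[OF Z] by (auto simp: is_ess_Inf_def)
  then have "AE \<omega> in M. \<omega> \<in> A \<longrightarrow> ereal (real_cond_exp M H S \<omega>) \<le> value_H Z \<omega>"
    by eventually_elim (auto simp: Y'_def)
  then have "AE \<omega> in M. \<omega> \<in> A \<longrightarrow> ereal_cond_exp M G (\<lambda>\<omega>. ereal (real_cond_exp M H S \<omega>)) \<omega>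
      \<le> ereal_cond_exp M G (value_H Z) \<omega>"
    by (intro G.ereal_cond_exp_mono_on A) auto
  moreover have "AE \<omega> in M. ereal_cond_exp M G (\<lambda>\<omega>. ereal (real_cond_exp M H S \<omega>)) \<omega>
      = ereal (real_cond_exp M G (real_cond_exp M H S) \<omega>)"
    by (intro G.ereal_cond_exp_ereal H.real_cond_exp_int S)
  moreover have "AE \<omega> in M. real_cond_exp M G (real_cond_exp M H S) \<omega> = real_cond_exp M G S \<omega>"
    using MH HG S by (rule G.real_cond_exp_nested_subalg)
  moreover have "AE \<omega> in M. real_cond_exp M G S \<omega>
      = real_cond_exp M G (\<lambda>\<omega>. l (X \<omega> - r)) \<omega> + real_cond_exp M G (\<lambda>\<omega>. (r - e) * Y \<omega> + - e) \<omega>"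
    unfolding S_def using Y by (intro G.real_cond_exp_add) auto
  moreover have "AE \<omega> in M. real_cond_exp M G (\<lambda>\<omega>. (r - e) * Y \<omega> + - e) \<omega>
      = real_cond_exp M G (\<lambda>\<omega>. (r - e) * Y \<omega>) \<omega> + real_cond_exp M G (\<lambda>_. - e) \<omega>"
    using Y by (intro G.real_cond_exp_add) auto
  moreover have "AE \<omega> in M. real_cond_exp M G (\<lambda>_. - e) \<omega> = - e"
    by (rule G.real_cond_exp_F_meas) auto
  moreover have "AE \<omega> in M. value_G \<omega> \<le> ereal (real_cond_exp M G (\<lambda>\<omega>. l (X \<omega> - r)) \<omega> + r * \<eta> \<omega>)"
    using value_G_is_ess_Inf by (simp add: is_ess_Inf_def)
  ultimately show ?thesis using YG G.real_cond_exp_cmult[OF Y, of "r - e"]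
  proof eventually_elim
    case (elim \<omega>)
    show ?case
    proof
      assume w: "\<omega> \<in> A"
      have "real_cond_exp M G (real_cond_exp M H S) \<omega>
          = real_cond_exp M G (\<lambda>\<omega>. l (X \<omega> - r)) \<omega> + (r - e) * \<eta> \<omega> - e"
        using elim w by simp
      also have "\<dots> = real_cond_exp M G (\<lambda>\<omega>. l (X \<omega> - r)) \<omega> + r * \<eta> \<omega> - e * (1 + \<eta> \<omega>)"
        by (simp add: algebra_simps)
      finally have "ereal (real_cond_exp M G (\<lambda>\<omega>. l (X \<omega> - r)) \<omega> + r * \<eta> \<omega> - e * (1 + \<eta> \<omega>))
          \<le> ereal_cond_exp M G (value_H Z) \<omega>"
        using elim(1,2) w by simp
      then have "ereal (real_cond_exp M G (\<lambda>\<omega>. l (X \<omega> - r)) \<omega> + r * \<eta> \<omega> - e * (1 + \<eta> \<omega>)) + ereal (e * (1 + \<eta> \<omega>))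
          \<le> ereal_cond_exp M G (value_H Z) \<omega> + ereal (e * (1 + \<eta> \<omega>))"
        by (rule add_right_mono)
      then have "ereal (real_cond_exp M G (\<lambda>\<omega>. l (X \<omega> - r)) \<omega> + r * \<eta> \<omega>)
          \<le> ereal_cond_exp M G (value_H Z) \<omega> + ereal (e * (1 + \<eta> \<omega>))"
        by simp
      with elim(7) show "value_G \<omega> \<le> ereal_cond_exp M G (value_H Z) \<omega> + ereal (e * (1 + \<eta> \<omega>))"
        by (rule order_trans)
    qed
  qed
qed

lemma one_in_densities: "(\<lambda>_. 1) \<in> densities"
proof -
  have "AE \<omega> in M. real_cond_exp M G (\<lambda>_. 1) \<omega> = 1"
    by (rule G.real_cond_exp_F_meas) auto
  then show ?thesis using \<eta>_dom by (simp add: densities_def L1_plus_def)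
qed

text \<open>
  The case where \<open>\<eta>\<close> is an endpoint of \<open>conjugate_dom l\<close>: the infimum over \<open>r\<close> need not be attained,
  but one deterministic \<open>r\<close> is nearly optimal uniformly over \<open>\<bar>x\<bar> \<le> C\<close>, so that \<open>Z = 1\<close> suffices.
\<close>

lemma value_G_le_boundary:
  assumes e: "0 < e"
  shows "AE \<omega> in M. (mono (\<lambda>y. l y - \<eta> \<omega> * y) \<or> antimono (\<lambda>y. l y - \<eta> \<omega> * y)) \<longrightarrow>
    value_G \<omega> \<le> ereal_cond_exp M G (value_H (\<lambda>_. 1)) \<omega> + ereal (e * (1 + \<eta> \<omega>))"
proof -
  \<comment> \<open>A suitable shift depends on \<open>\<eta> \<omega>\<close>. Each
    \<open>S k\<close> is closed, so \<open>\<eta>\<close> lying in it is an event, and countably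
    many events replace a measurable choice of the shift. The bound \<open>m\<close> below makes the
    slope integrable.\<close>
  define S where "S k = {z. \<forall>x. \<bar>x\<bar> \<le> C \<longrightarrow> (\<forall>r. l (x - of_int k) + of_int k * z - e \<le> l (x - r) + r * z)}" for k :: int
  define A where "A k m = {\<omega>\<in>space M. \<eta> \<omega> \<in> S k \<and> \<bar>\<eta> \<omega>\<bar> \<le> real m}" for k :: int and m :: nat
  have "closed (S k)" for k
    unfolding S_def by (intro closed_Collect_all closed_Collect_imp open_Collect_const closed_Collect_le continuous_intros)
  then have "S k \<inter> {- real m..real m} \<in> sets borel" for k m by auto
  from measurable_sets[OF \<eta>_G this]
  have "\<eta> -` (S k \<inter> {- real m..real m}) \<inter> space G \<in> sets G" for k m .
  moreover have "A k m = \<eta> -` (S k \<inter> {- real m..real m}) \<inter> space G" for k m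
    using MG by (auto simp: A_def subalgebra_def)
  ultimately have A: "A k m \<in> sets G" for k m by simp
  have on_A: "AE \<omega> in M. \<omega> \<in> A k m \<longrightarrow>
      value_G \<omega> \<le> ereal_cond_exp M G (value_H (\<lambda>_. 1)) \<omega> + ereal (e * (1 + \<eta> \<omega>))" for k m
  proof -
    \<comment> \<open>Since this slope is \<open>G\<close>-measurable, conditioning on
      \<open>G\<close> or \<open>H\<close> leaves it unchanged, which corresponds to the density
      1.\<close>
    define Y where "Y \<omega> = indicator (A k m) \<omega> * \<eta> \<omega>" for \<omega>
    have YG: "Y \<in> borel_measurable G" unfolding Y_def using A[of k m] \<eta>_G by measurable
    have Y: "integrable M Y"
      using measurable_from_subalg[OF MG YG]
      by (intro integrable_const_bound[of _ "real m"]) (auto simp: Y_def A_def indicator_def)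
    have EY: "AE \<omega> in M. real_cond_exp M G Y \<omega> = Y \<omega>" "AE \<omega> in M. real_cond_exp M H Y \<omega> = Y \<omega>"
      using Y YG measurable_from_subalg[OF HG YG]
      by (auto intro: G.real_cond_exp_F_meas H.real_cond_exp_F_meas)
    have "AE \<omega> in M. \<omega> \<in> A k m \<longrightarrow> real_cond_exp M G Y \<omega> = \<eta> \<omega>"
      using EY(1) by eventually_elim (simp add: Y_def)
    moreover have "AE \<omega> in M. \<omega> \<in> A k m \<longrightarrow> real_cond_exp M H Y \<omega> = \<eta> \<omega> * 1"
      using EY(2) by eventually_elim (simp add: Y_def)
    moreover have "AE \<omega> in M. \<omega> \<in> A k m \<longrightarrow>
        (\<forall>r'. l (X \<omega> - k) + k * Y \<omega> - e * (1 + Y \<omega>) \<le> l (X \<omega> - r') + r' * Y \<omega>)"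
      using X_bounded \<eta>_nonneg
    proof eventually_elim
      case (elim \<omega>)
      show ?case
      proof (intro impI allI)
        fix r' assume w: "\<omega> \<in> A k m"
        then have "Y \<omega> = \<eta> \<omega>" "\<eta> \<omega> \<in> S k" by (auto simp: Y_def A_def)
        with elim have "l (X \<omega> - k) + k * Y \<omega> - e \<le> l (X \<omega> - r') + r' * Y \<omega>" "0 \<le> Y \<omega>"
          by (auto simp: S_def)
        moreover have "0 \<le> e * Y \<omega>" using calculation e by simp
        ultimately show "l (X \<omega> - k) + k * Y \<omega> - e * (1 + Y \<omega>) \<le> l (X \<omega> - r') + r' * Y \<omega>"
          by (simp add: distrib_left)
      qed
    qed
    ultimately show ?thesis
      by - (rule value_G_le_cond_exp_value_H[OF one_in_densities A Y])
  qed
  have "AE \<omega> in M. \<forall>k m. \<omega> \<in> A k m \<longrightarrow>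
      value_G \<omega> \<le> ereal_cond_exp M G (value_H (\<lambda>_. 1)) \<omega> + ereal (e * (1 + \<eta> \<omega>))"
    unfolding AE_all_countable by (intro allI on_A)
  then show ?thesis using \<eta>_dom AE_space
  proof eventually_elim
    case (elim \<omega>)
    show ?case
    proof
      assume "mono (\<lambda>y. l y - \<eta> \<omega> * y) \<or> antimono (\<lambda>y. l y - \<eta> \<omega> * y)"
      from boundary_slope_near_min[OF elim(2) e this, of C]
      obtain k :: int where "\<eta> \<omega> \<in> S k" by (auto simp: S_def)
      moreover obtain m :: nat where "\<bar>\<eta> \<omega>\<bar> \<le> real m" using real_arch_simple by blast
      ultimately have "\<omega> \<in> A k m" using elim(3) by (simp add: A_def)
      with elim(1) show "value_G \<omega> \<le> ereal_cond_exp M G (value_H (\<lambda>_. 1)) \<omega> + ereal (e * (1 + \<eta> \<omega>))"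
        by blast
    qed
  qed
qed

text \<open>The two inequalities compare \<open>k\<close> with \<open>k + 1\<close> and
  \<open>k - 1\<close> in the objective \<open>E[l(X - r) | G] + r \<eta>\<close> at
  \<open>r = k h\<close>. Such a \<open>k\<close> exists because the objective is nondecreasing for
  large \<open>k\<close> and nonincreasing for small \<open>k\<close>, as \<open>\<eta>\<close> is
  strictly above some chord slope of \<open>l\<close> and strictly below another.\<close>

lemma grid_local_min:
  assumes h: "0 < h"
  shows "AE \<omega> in M. \<not> mono (\<lambda>y. l y - \<eta> \<omega> * y) \<and> \<not> antimono (\<lambda>y. l y - \<eta> \<omega> * y) \<longrightarrow>
    (\<exists>k::int.
      real_cond_exp M G (\<lambda>\<omega>. l (X \<omega> - k * h)) \<omega> - real_cond_exp M G (\<lambda>\<omega>. l (X \<omega> - k * h - h)) \<omega> \<le> h * \<eta> \<omega> \<and>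
      h * \<eta> \<omega> \<le> real_cond_exp M G (\<lambda>\<omega>. l (X \<omega> - k * h + h)) \<omega> - real_cond_exp M G (\<lambda>\<omega>. l (X \<omega> - k * h)) \<omega>)"
proof -
  define f where "f k = real_cond_exp M G (\<lambda>\<omega>. l (X \<omega> - of_int k * h))" for k :: int
  have shift: "(\<lambda>\<omega>. l (X \<omega> - of_int (k + 1) * h)) = (\<lambda>\<omega>. l (X \<omega> - of_int k * h - h))"
      "(\<lambda>\<omega>. l (X \<omega> - of_int (k - 1) * h)) = (\<lambda>\<omega>. l (X \<omega> - of_int k * h + h))" for k :: int
    by (simp_all add: algebra_simps)
  \<comment> \<open>By convexity, increments of \<open>l\<close> grow with the base point, so
    replacing \<open>X\<close> by \<open>C\<close> bounds them by deterministic numbers. Below,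
    \<open>- C\<close> gives the bound from the other side.\<close>
  have below: "AE \<omega> in M. \<forall>k::int. f k \<omega> - f (k + 1) \<omega> \<le> l (C - of_int k * h) - l (C - of_int k * h - h)"
  proof (subst AE_all_countable, intro allI)
    fix k :: int
    let ?D = "\<lambda>\<omega>. l (X \<omega> - of_int k * h) - l (X \<omega> - of_int (k + 1) * h)"
    have "AE \<omega> in M. real_cond_exp M G ?D \<omega> \<le> l (C - of_int k * h) - l (C - of_int k * h - h)"
    proof (intro G.real_cond_exp_le_c)
      show "AE \<omega> in M. ?D \<omega> \<le> l (C - of_int k * h) - l (C - of_int k * h - h)"
        using X_bounded
      proof eventually_elim
        case (elim \<omega>)
        then show ?case
          using convex_increment_mono[OF convex, of "X \<omega> - of_int k * h - h" "C - of_int k * h - h" h] h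
          unfolding shift(1)[THEN fun_cong] by simp
      qed
    qed simp
    moreover have "AE \<omega> in M. real_cond_exp M G ?D \<omega> = f k \<omega> - f (k + 1) \<omega>"
      unfolding f_def by (intro G.real_cond_exp_diff integrable_loss)
    ultimately show "AE \<omega> in M. f k \<omega> - f (k + 1) \<omega> \<le> l (C - of_int k * h) - l (C - of_int k * h - h)"
      by eventually_elim simp
  qed
  have above: "AE \<omega> in M. \<forall>k::int. l (- C - of_int k * h + h) - l (- C - of_int k * h) \<le> f (k - 1) \<omega> - f k \<omega>"
  proof (subst AE_all_countable, intro allI)
    fix k :: int
    let ?D = "\<lambda>\<omega>. l (X \<omega> - of_int (k - 1) * h) - l (X \<omega> - of_int k * h)"
    have "AE \<omega> in M. real_cond_exp M G ?D \<omega> \<ge> l (- C - of_int k * h + h) - l (- C - of_int k * h)"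
    proof (intro G.real_cond_exp_ge_c)
      show "AE \<omega> in M. ?D \<omega> \<ge> l (- C - of_int k * h + h) - l (- C - of_int k * h)"
        using X_bounded
      proof eventually_elim
        case (elim \<omega>)
        then show ?case
          using convex_increment_mono[OF convex, of "- C - of_int k * h" "X \<omega> - of_int k * h" h] h
          unfolding shift(2)[THEN fun_cong] by simp
      qed
    qed simp
    moreover have "AE \<omega> in M. real_cond_exp M G ?D \<omega> = f (k - 1) \<omega> - f k \<omega>"
      unfolding f_def by (intro G.real_cond_exp_diff integrable_loss)
    ultimately show "AE \<omega> in M. l (- C - of_int k * h + h) - l (- C - of_int k * h) \<le> f (k - 1) \<omega> - f k \<omega>"
      by eventually_elim simp
  qed
  from below above show ?thesis
  proof eventually_elim
    case (elim \<omega>)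
    show ?case
    proof (intro impI, elim conjE)
      assume m: "\<not> mono (\<lambda>y. l y - \<eta> \<omega> * y)" and a: "\<not> antimono (\<lambda>y. l y - \<eta> \<omega> * y)"
      define g where "g k = f k \<omega> + of_int k * (h * \<eta> \<omega>)" for k :: int
      obtain k0 where k0: "\<And>k. k0 \<le> k \<Longrightarrow> l (C - of_int k * h) - l (C - of_int k * h - h) \<le> h * \<eta> \<omega>"
        using increments_below_eventually[OF m h, of C] by auto
      obtain k1 where k1: "\<And>k. k \<le> k1 \<Longrightarrow> h * \<eta> \<omega> \<le> l (- C - of_int k * h + h) - l (- C - of_int k * h)"
        using increments_above_eventually[OF a h, of "- C"] by auto
      have "\<exists>k. g k \<le> g (k + 1) \<and> g k \<le> g (k - 1)"
      proof (rule int_local_min_exists)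
        show "g k \<le> g (k + 1)" if "k0 \<le> k" for k
          using elim(1)[rule_format, of k] k0[OF that] by (simp add: g_def algebra_simps)
        show "g k \<le> g (k - 1)" if "k \<le> k1" for k
          using elim(2)[rule_format, of k] k1[OF that] by (simp add: g_def algebra_simps)
      qed
      then obtain k where "g k \<le> g (k + 1)" "g k \<le> g (k - 1)" by blast
      then have "f k \<omega> - f (k + 1) \<omega> \<le> h * \<eta> \<omega> \<and> h * \<eta> \<omega> \<le> f (k - 1) \<omega> - f k \<omega>"
        by (auto simp: g_def algebra_simps)
      then show "\<exists>k::int.
        real_cond_exp M G (\<lambda>\<omega>. l (X \<omega> - k * h)) \<omega> - real_cond_exp M G (\<lambda>\<omega>. l (X \<omega> - k * h - h)) \<omega> \<le> h * \<eta> \<omega> \<and>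
        h * \<eta> \<omega> \<le> real_cond_exp M G (\<lambda>\<omega>. l (X \<omega> - k * h + h)) \<omega> - real_cond_exp M G (\<lambda>\<omega>. l (X \<omega> - k * h)) \<omega>"
        unfolding f_def shift by blast
    qed
  qed
qed

text \<open>The density built in the proof depends on the event considered. Stating the bound for an
  arbitrary common upper bound \<open>U\<close> lets the countably many events be combined without
  gluing their densities.\<close>

lemma value_G_le_interior:
  assumes h: "0 < h"
    and U: "\<And>Z. Z \<in> densities \<Longrightarrow> AE \<omega> in M. ereal_cond_exp M G (value_H Z) \<omega> \<le> U \<omega>"
  shows "AE \<omega> in M. \<not> mono (\<lambda>y. l y - \<eta> \<omega> * y) \<and> \<not> antimono (\<lambda>y. l y - \<eta> \<omega> * y) \<longrightarrow>
    value_G \<omega> \<le> U \<omega> + ereal (h * (1 + \<eta> \<omega>))"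
proof -
  \<comment> \<open>\<open>D1\<close> and \<open>D0\<close> are the slopes of the chords of
    \<open>l\<close> to the right and to the left of \<open>X - k h\<close>. On the events
    \<open>A k m\<close> their conditional expectations enclose \<open>\<eta>\<close>, and the lower
    bound on \<open>\<eta>\<close> keeps \<open>1 / \<eta>\<close> bounded.\<close>
  define D1 where "D1 k \<omega> = (l (X \<omega> - of_int k * h + h) - l (X \<omega> - of_int k * h)) / h" for k :: int and \<omega>
  define D0 where "D0 k \<omega> = (l (X \<omega> - of_int k * h) - l (X \<omega> - of_int k * h - h)) / h" for k :: int and \<omega>
  define e1 where "e1 k = real_cond_exp M G (D1 k)" for k
  define e0 where "e0 k = real_cond_exp M G (D0 k)" for k
  define A where "A k m = {\<omega>\<in>space M. e0 k \<omega> \<le> \<eta> \<omega> \<and> \<eta> \<omega> \<le> e1 k \<omega> \<and> 1 / real (Suc m) \<le> \<eta> \<omega>}" for k and m :: nat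
  have int_l: "integrable M (\<lambda>\<omega>. l (X \<omega> - of_int k * h + h))" "integrable M (\<lambda>\<omega>. l (X \<omega> - of_int k * h - h))" for k :: int
    using integrable_loss[of "of_int k * h - h"] integrable_loss[of "of_int k * h + h"]
    by (simp_all add: algebra_simps)
  have D: "integrable M (D1 k)" "integrable M (D0 k)" for k
    unfolding D1_def D0_def using int_l h by simp_all
  note [measurable] = borel_measurable_integrable[OF D(1)] borel_measurable_integrable[OF D(2)]
  have eG: "e1 k \<in> borel_measurable G" "e0 k \<in> borel_measurable G" for k
    by (simp_all add: e1_def e0_def)
  have A: "A k m \<in> sets G" for k m
  proof -
    have "{\<omega>\<in>space G. e0 k \<omega> \<le> \<eta> \<omega> \<and> \<eta> \<omega> \<le> e1 k \<omega> \<and> 1 / real (Suc m) \<le> \<eta> \<omega>} \<in> sets G"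
      using eG \<eta>_G by measurable
    then show ?thesis using MG by (simp add: A_def subalgebra_def)
  qed
  have on_A: "AE \<omega> in M. \<omega> \<in> A k m \<longrightarrow> value_G \<omega> \<le> U \<omega> + ereal (h * (1 + \<eta> \<omega>))" for k m
  proof -
    define r where "r = of_int k * h"
    \<comment> \<open>The weight solves \<open>lam * e1 + (1 - lam) * e0 = \<eta>\<close>. If the
      denominator vanishes on the event, division by zero gives 0, which is correct because then
      \<open>e0 = \<eta>\<close>.\<close>
    define lam where "lam \<omega> = (\<eta> \<omega> - e0 k \<omega>) / (e1 k \<omega> - e0 k \<omega>)" for \<omega>
    define a where "a \<omega> = indicator (A k m) \<omega> * lam \<omega>" for \<omega>
    define b where "b \<omega> = indicator (A k m) \<omega> * (1 - lam \<omega>)" for \<omega>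
    define Y where "Y \<omega> = a \<omega> * D1 k \<omega> + b \<omega> * D0 k \<omega>" for \<omega>
    \<comment> \<open>Dividing by \<open>\<eta>\<close> normalises the conditional expectation of
      the slope given \<open>H\<close>. Off the event the density is 1, where
      \<open>\<eta> * Z = \<eta>\<close> stays in the domain of the conjugate.\<close>
    define c where "c \<omega> = indicator (A k m) \<omega> / \<eta> \<omega>" for \<omega>
    define Z where "Z \<omega> = c \<omega> * real_cond_exp M H Y \<omega> + (1 - indicator (A k m) \<omega>)" for \<omega>
    have AG [measurable]: "A k m \<in> sets G" and AH: "A k m \<in> sets H" and AM: "A k m \<in> sets M"
      using A HG MG by (auto simp: subalgebra_def)
    have lam_props: "0 \<le> lam \<omega>" "lam \<omega> \<le> 1" "lam \<omega> * e1 k \<omega> + (1 - lam \<omega>) * e0 k \<omega> = \<eta> \<omega>"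
      if "\<omega> \<in> A k m" for \<omega>
    proof -
      have le: "e0 k \<omega> \<le> \<eta> \<omega>" "\<eta> \<omega> \<le> e1 k \<omega>" using that by (auto simp: A_def)
      then show "0 \<le> lam \<omega>" "lam \<omega> \<le> 1"
        unfolding lam_def by (auto simp: divide_le_eq)
      have "lam \<omega> * (e1 k \<omega> - e0 k \<omega>) = \<eta> \<omega> - e0 k \<omega>"
        unfolding lam_def using le by auto
      then show "lam \<omega> * e1 k \<omega> + (1 - lam \<omega>) * e0 k \<omega> = \<eta> \<omega>" by (simp add: algebra_simps)
    qed
    have lamG: "lam \<in> borel_measurable G" unfolding lam_def using eG \<eta>_G by measurable
    then have abcG: "a \<in> borel_measurable G" "b \<in> borel_measurable G" "c \<in> borel_measurable G"
      unfolding a_def b_def c_def using \<eta>_G by measurable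
    then have [measurable]: "a \<in> borel_measurable M" "b \<in> borel_measurable M" "c \<in> borel_measurable M"
      using measurable_from_subalg[OF MG] by blast+
    have ab01: "0 \<le> a \<omega>" "a \<omega> \<le> 1" "0 \<le> b \<omega>" "b \<omega> \<le> 1" for \<omega>
      using lam_props[of \<omega>] by (auto simp: a_def b_def indicator_def)
    have aD: "integrable M (\<lambda>\<omega>. a \<omega> * D1 k \<omega>)" and bD: "integrable M (\<lambda>\<omega>. b \<omega> * D0 k \<omega>)"
      using ab01 by (auto intro!: integrable_bounded_mult[where B=1] D AE_I2)
    have Y: "integrable M Y" unfolding Y_def using aD bD by simp
    note [measurable] = borel_measurable_integrable[OF Y]
    have D0: "0 \<le> D1 k \<omega>" "0 \<le> D0 k \<omega>" for \<omega>
      using increasing h by (auto simp: D1_def D0_def mono_def)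
    have Y0: "0 \<le> Y \<omega>" for \<omega> unfolding Y_def using D0 ab01 by simp
    \<comment> \<open>Both chord slopes satisfy the same inequality with correction
      \<open>- h\<close>, which is affine in the slope and hence survives convex
      combination.\<close>
    have support: "l (X \<omega> - r) + (y - (X \<omega> - r) - h) * Y \<omega> \<le> l y" if "\<omega> \<in> A k m" for \<omega> y
    proof -
      have ab: "a \<omega> + b \<omega> = 1" using that by (simp add: a_def b_def)
      have "a \<omega> * (l (X \<omega> - r) + (y - (X \<omega> - r) - h) * D1 k \<omega>) \<le> a \<omega> * l y"
        using chord_support_right[OF h, of "X \<omega> - r" y] ab01
        by (intro mult_left_mono) (simp_all add: D1_def r_def)
      moreover have "b \<omega> * (l (X \<omega> - r) + (y - (X \<omega> - r) - h) * D0 k \<omega>) \<le> b \<omega> * l y"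
        using chord_support_left[OF h, of "X \<omega> - r" y] ab01
        by (intro mult_left_mono) (simp_all add: D0_def r_def)
      ultimately have "(a \<omega> + b \<omega>) * l (X \<omega> - r) + (y - (X \<omega> - r) - h) * Y \<omega> \<le> (a \<omega> + b \<omega>) * l y"
        by (simp add: Y_def algebra_simps)
      with ab show ?thesis by simp
    qed
    have YG: "AE \<omega> in M. real_cond_exp M G Y \<omega> = indicator (A k m) \<omega> * \<eta> \<omega>"
    proof -
      have "AE \<omega> in M. real_cond_exp M G Y \<omega>
          = real_cond_exp M G (\<lambda>\<omega>. a \<omega> * D1 k \<omega>) \<omega> + real_cond_exp M G (\<lambda>\<omega>. b \<omega> * D0 k \<omega>) \<omega>"
        unfolding Y_def using aD bD by (rule G.real_cond_exp_add)
      moreover have "AE \<omega> in M. real_cond_exp M G (\<lambda>\<omega>. a \<omega> * D1 k \<omega>) \<omega> = a \<omega> * e1 k \<omega>"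
        unfolding e1_def by (intro G.real_cond_exp_mult abcG aD) simp
      moreover have "AE \<omega> in M. real_cond_exp M G (\<lambda>\<omega>. b \<omega> * D0 k \<omega>) \<omega> = b \<omega> * e0 k \<omega>"
        unfolding e0_def by (intro G.real_cond_exp_mult abcG bD) simp
      ultimately show ?thesis
        by eventually_elim (use lam_props in \<open>auto simp: a_def b_def indicator_def\<close>)
    qed
    have EY: "integrable M (real_cond_exp M H Y)" by (rule H.real_cond_exp_int[OF Y])
    have c_bound: "\<bar>c \<omega>\<bar> \<le> real (Suc m)" for \<omega>
    proof (cases "\<omega> \<in> A k m")
      case True
      then have "1 / real (Suc m) \<le> \<eta> \<omega>" by (simp add: A_def)
      moreover have p: "0 < 1 / real (Suc m)" by simp
      ultimately have "0 < \<eta> \<omega>" by linarith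
      moreover have "1 / \<eta> \<omega> \<le> 1 / (1 / real (Suc m))"
        using \<open>1 / real (Suc m) \<le> \<eta> \<omega>\<close> p by (intro frac_le) auto
      ultimately have "0 < \<eta> \<omega>" "1 / \<eta> \<omega> \<le> real (Suc m)" by simp_all
      then show ?thesis using True by (simp add: c_def)
    qed (simp add: c_def)
    have cEY: "integrable M (\<lambda>\<omega>. c \<omega> * real_cond_exp M H Y \<omega>)"
      using c_bound by (intro integrable_bounded_mult[where B="real (Suc m)"] EY) auto
    have pos: "0 < \<eta> \<omega>" if "\<omega> \<in> A k m" for \<omega>
      using that by (auto simp: A_def intro: less_le_trans[of 0 "1 / real (Suc m)"])
    have "Z \<in> densities"
      unfolding densities_def L1_plus_def
    proof (intro CollectI conjI)
      show "Z \<in> borel_measurable H"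
        unfolding Z_def using measurable_from_subalg[OF HG abcG(3)] AH by measurable
      show "integrable M Z" unfolding Z_def using cEY AM by (simp add: integrable_real_indicator less_top[symmetric])
      have EY0: "AE \<omega> in M. 0 \<le> real_cond_exp M H Y \<omega>"
        using Y0 by (intro H.real_cond_exp_pos) auto
      then show "AE \<omega> in M. 0 \<le> Z \<omega>"
        by eventually_elim (use pos in \<open>auto simp: Z_def c_def indicator_def intro: divide_nonneg_pos\<close>)
      show "AE \<omega> in M. \<eta> \<omega> * Z \<omega> \<in> conjugate_dom l"
      proof -
        have XY: "integrable M (\<lambda>\<omega>. X \<omega> * Y \<omega>)"
          using X_bounded by (rule integrable_bounded_mult[OF Y X])
        \<comment> \<open>Rearranging \<open>support\<close> bounds \<open>y * Y - l y\<close> by an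
          integrable variable free of \<open>y\<close>. Its conditional expectation \<open>B\<close>
          therefore bounds the conjugate of \<open>l\<close> at \<open>real_cond_exp M H Y\<close>
          on the event.\<close>
        define B where "B = real_cond_exp M H (\<lambda>\<omega>. X \<omega> * Y \<omega> + ((h - r) * Y \<omega> - l (X \<omega> - r)))"
        have bound: "AE \<omega> in M. \<omega> \<in> A k m \<longrightarrow> y * real_cond_exp M H Y \<omega> - l y \<le> B \<omega>" for y
        proof -
          have "AE \<omega> in M. \<omega> \<in> A k m \<longrightarrow> real_cond_exp M H (\<lambda>\<omega>. y * Y \<omega> - l y) \<omega> \<le> B \<omega>"
            unfolding B_def
          proof (rule H.real_cond_exp_mono_on[OF AH])
            show "AE \<omega> in M. \<omega> \<in> A k m \<longrightarrow>
                y * Y \<omega> - l y \<le> X \<omega> * Y \<omega> + ((h - r) * Y \<omega> - l (X \<omega> - r))"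
            proof (intro AE_I2 impI)
              fix \<omega> assume "\<omega> \<in> A k m"
              from support[OF this, of y]
              show "y * Y \<omega> - l y \<le> X \<omega> * Y \<omega> + ((h - r) * Y \<omega> - l (X \<omega> - r))"
                by (simp add: algebra_simps)
            qed
          qed (use Y XY in auto)
          moreover have "AE \<omega> in M. real_cond_exp M H (\<lambda>\<omega>. y * Y \<omega> - l y) \<omega>
              = real_cond_exp M H (\<lambda>\<omega>. y * Y \<omega>) \<omega> - real_cond_exp M H (\<lambda>_. l y) \<omega>"
            using Y by (intro H.real_cond_exp_diff) auto
          moreover have "AE \<omega> in M. real_cond_exp M H (\<lambda>_. l y) \<omega> = l y"
            by (rule H.real_cond_exp_F_meas) auto
          ultimately show ?thesis using H.real_cond_exp_cmult[OF Y, of y]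
            by eventually_elim auto
        qed
        have "AE \<omega> in M. \<forall>q. \<omega> \<in> A k m \<longrightarrow> of_rat q * real_cond_exp M H Y \<omega> - l (of_rat q) \<le> B \<omega>"
          by (subst AE_all_countable) (intro allI bound)
        then show ?thesis using EY0 \<eta>_dom
        proof eventually_elim
          case (elim \<omega>)
          show ?case
          proof (cases "\<omega> \<in> A k m")
            case True
            then have "y * real_cond_exp M H Y \<omega> - l y \<le> B \<omega>" for y
              using elim(1) by - (rule rational_conjugate_bound, simp)
            then have "real_cond_exp M H Y \<omega> \<in> conjugate_dom l"
              using elim(2) by (intro in_conjugate_domI)
            moreover have "\<eta> \<omega> * Z \<omega> = real_cond_exp M H Y \<omega>"
              using True pos[OF True] by (simp add: Z_def c_def)
            ultimately show ?thesis by simp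
          next
            case False
            then show ?thesis using elim(3) by (simp add: Z_def c_def)
          qed
        qed
      qed
      show "AE \<omega> in M. real_cond_exp M G Z \<omega> = 1"
      proof -
        have "AE \<omega> in M. real_cond_exp M G Z \<omega> = real_cond_exp M G (\<lambda>\<omega>. c \<omega> * real_cond_exp M H Y \<omega>) \<omega>
            + real_cond_exp M G (\<lambda>\<omega>. 1 - indicator (A k m) \<omega>) \<omega>"
          unfolding Z_def using cEY AM by (intro G.real_cond_exp_add) (auto simp: integrable_real_indicator less_top[symmetric])
        moreover have "AE \<omega> in M. real_cond_exp M G (\<lambda>\<omega>. c \<omega> * real_cond_exp M H Y \<omega>) \<omega>
            = c \<omega> * real_cond_exp M G (real_cond_exp M H Y) \<omega>"
          by (intro G.real_cond_exp_mult abcG cEY) simp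
        moreover have "AE \<omega> in M. real_cond_exp M G (real_cond_exp M H Y) \<omega> = real_cond_exp M G Y \<omega>"
          using MH HG Y by (rule G.real_cond_exp_nested_subalg)
        moreover have "AE \<omega> in M. real_cond_exp M G (\<lambda>\<omega>. 1 - indicator (A k m) \<omega>) \<omega> = 1 - indicator (A k m) \<omega>"
          using AM by (intro G.real_cond_exp_F_meas) (auto simp: integrable_real_indicator less_top[symmetric])
        ultimately show ?thesis using YG
        proof eventually_elim
          case (elim \<omega>)
          then show ?case using pos[of \<omega>] by (cases "\<omega> \<in> A k m") (simp_all add: c_def)
        qed
      qed
    qed
    have "AE \<omega> in M. \<omega> \<in> A k m \<longrightarrow>
        value_G \<omega> \<le> ereal_cond_exp M G (value_H Z) \<omega> + ereal (h * (1 + \<eta> \<omega>))"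
    proof (rule value_G_le_cond_exp_value_H[OF \<open>Z \<in> densities\<close> AG Y])
      show "AE \<omega> in M. \<omega> \<in> A k m \<longrightarrow> real_cond_exp M H Y \<omega> = \<eta> \<omega> * Z \<omega>"
      proof (intro AE_I2 impI)
        fix \<omega> assume "\<omega> \<in> A k m"
        with pos[OF this] show "real_cond_exp M H Y \<omega> = \<eta> \<omega> * Z \<omega>" by (simp add: Z_def c_def)
      qed
      show "AE \<omega> in M. \<omega> \<in> A k m \<longrightarrow> real_cond_exp M G Y \<omega> = \<eta> \<omega>"
        using YG by eventually_elim simp
      show "AE \<omega> in M. \<omega> \<in> A k m \<longrightarrow>
          (\<forall>r'. l (X \<omega> - r) + r * Y \<omega> - h * (1 + Y \<omega>) \<le> l (X \<omega> - r') + r' * Y \<omega>)"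
      proof (intro AE_I2 impI allI)
        fix \<omega> r' assume "\<omega> \<in> A k m"
        from support[OF this, of "X \<omega> - r'"] h
        show "l (X \<omega> - r) + r * Y \<omega> - h * (1 + Y \<omega>) \<le> l (X \<omega> - r') + r' * Y \<omega>"
          by (simp add: algebra_simps)
      qed
    qed
    then show ?thesis using U[OF \<open>Z \<in> densities\<close>]
    proof eventually_elim
      case (elim \<omega>)
      from elim(2) have "ereal_cond_exp M G (value_H Z) \<omega> + ereal (h * (1 + \<eta> \<omega>)) \<le> U \<omega> + ereal (h * (1 + \<eta> \<omega>))"
        by (rule add_right_mono)
      with elim(1) show ?case using order_trans by blast
    qed
  qed
  have "AE \<omega> in M. \<forall>k m. \<omega> \<in> A k m \<longrightarrow> value_G \<omega> \<le> U \<omega> + ereal (h * (1 + \<eta> \<omega>))"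
    unfolding AE_all_countable by (intro allI on_A)
  moreover have "AE \<omega> in M. \<forall>k. e1 k \<omega> = (real_cond_exp M G (\<lambda>\<omega>. l (X \<omega> - of_int k * h + h)) \<omega> - real_cond_exp M G (\<lambda>\<omega>. l (X \<omega> - of_int k * h)) \<omega>) / h"
  proof (subst AE_all_countable, intro allI)
    fix k :: int
    let ?d = "\<lambda>\<omega>. l (X \<omega> - of_int k * h + h) - l (X \<omega> - of_int k * h)"
    have "AE \<omega> in M. e1 k \<omega> = real_cond_exp M G ?d \<omega> / h"
      unfolding e1_def D1_def using int_l by (intro G.real_cond_exp_cdiv) simp
    moreover have "AE \<omega> in M. real_cond_exp M G ?d \<omega>
        = real_cond_exp M G (\<lambda>\<omega>. l (X \<omega> - of_int k * h + h)) \<omega> - real_cond_exp M G (\<lambda>\<omega>. l (X \<omega> - of_int k * h)) \<omega>"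
      using int_l by (intro G.real_cond_exp_diff) simp_all
    ultimately show "AE \<omega> in M. e1 k \<omega> = (real_cond_exp M G (\<lambda>\<omega>. l (X \<omega> - of_int k * h + h)) \<omega> - real_cond_exp M G (\<lambda>\<omega>. l (X \<omega> - of_int k * h)) \<omega>) / h"
      by eventually_elim simp
  qed
  moreover have "AE \<omega> in M. \<forall>k. e0 k \<omega> = (real_cond_exp M G (\<lambda>\<omega>. l (X \<omega> - of_int k * h)) \<omega> - real_cond_exp M G (\<lambda>\<omega>. l (X \<omega> - of_int k * h - h)) \<omega>) / h"
  proof (subst AE_all_countable, intro allI)
    fix k :: int
    let ?d = "\<lambda>\<omega>. l (X \<omega> - of_int k * h) - l (X \<omega> - of_int k * h - h)"
    have "AE \<omega> in M. e0 k \<omega> = real_cond_exp M G ?d \<omega> / h"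
      unfolding e0_def D0_def using int_l by (intro G.real_cond_exp_cdiv) simp
    moreover have "AE \<omega> in M. real_cond_exp M G ?d \<omega>
        = real_cond_exp M G (\<lambda>\<omega>. l (X \<omega> - of_int k * h)) \<omega> - real_cond_exp M G (\<lambda>\<omega>. l (X \<omega> - of_int k * h - h)) \<omega>"
      using int_l by (intro G.real_cond_exp_diff) simp_all
    ultimately show "AE \<omega> in M. e0 k \<omega> = (real_cond_exp M G (\<lambda>\<omega>. l (X \<omega> - of_int k * h)) \<omega> - real_cond_exp M G (\<lambda>\<omega>. l (X \<omega> - of_int k * h - h)) \<omega>) / h"
      by eventually_elim simp
  qed
  ultimately show ?thesis using grid_local_min[OF h] \<eta>_nonneg AE_space
  proof eventually_elim
    case (elim \<omega>)
    show ?case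
    proof
      assume slope: "\<not> mono (\<lambda>y. l y - \<eta> \<omega> * y) \<and> \<not> antimono (\<lambda>y. l y - \<eta> \<omega> * y)"
      have e: "real_cond_exp M G (\<lambda>\<omega>. l (X \<omega> - of_int k * h + h)) \<omega> - real_cond_exp M G (\<lambda>\<omega>. l (X \<omega> - of_int k * h)) \<omega> = h * e1 k \<omega>"
        "real_cond_exp M G (\<lambda>\<omega>. l (X \<omega> - of_int k * h)) \<omega> - real_cond_exp M G (\<lambda>\<omega>. l (X \<omega> - of_int k * h - h)) \<omega> = h * e0 k \<omega>" for k :: int
        using elim(2,3) h by simp_all
      from elim(4) slope obtain k :: int where "h * e0 k \<omega> \<le> h * \<eta> \<omega>" "h * \<eta> \<omega> \<le> h * e1 k \<omega>"
        unfolding e by blast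
      then have k: "e0 k \<omega> \<le> \<eta> \<omega>" "\<eta> \<omega> \<le> e1 k \<omega>" using h by simp_all
      \<comment> \<open>For \<open>\<eta> \<omega> = 0\<close> the function
        \<open>l y - \<eta> \<omega> * y\<close> is \<open>l\<close> itself, which is
        increasing.\<close>
      have "\<eta> \<omega> \<noteq> 0" using slope increasing by (auto simp: mono_def)
      with elim(5) have "0 < \<eta> \<omega>" by simp
      then obtain m where "inverse (real (Suc m)) < \<eta> \<omega>" using reals_Archimedean by blast
      with k elim(6) have "\<omega> \<in> A k m" by (simp add: A_def divide_inverse)
      with elim(1) show "value_G \<omega> \<le> U \<omega> + ereal (h * (1 + \<eta> \<omega>))" by blast
    qed
  qed
qed

text \<open>The boundary and interior cases cover every outcome. Their common error
  \<open>e * (1 + \<eta>)\<close> is not uniformly small, but it vanishes pointwise along a sequence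
  of \<open>e\<close>, which suffices for an almost sure bound.\<close>

theorem value_G_is_ess_Sup:
  "is_ess_Sup M densities (\<lambda>Z. ereal_cond_exp M G (value_H Z)) value_G"
  unfolding is_ess_Sup_def
proof (intro conjI ballI impI)
  show "value_G \<in> borel_measurable M" using value_G_is_ess_Inf by (simp add: is_ess_Inf_def)
  show "AE \<omega> in M. ereal_cond_exp M G (value_H Z) \<omega> \<le> value_G \<omega>" if "Z \<in> densities" for Z
    by (rule cond_exp_value_H_le[OF that])
  fix U assume U: "\<forall>Z\<in>densities. AE \<omega> in M. ereal_cond_exp M G (value_H Z) \<omega> \<le> U \<omega>"
  have "AE \<omega> in M. value_G \<omega> \<le> U \<omega> + ereal (e * (1 + \<eta> \<omega>))" if "0 < e" for e
  proof -
    have "AE \<omega> in M. \<not> mono (\<lambda>y. l y - \<eta> \<omega> * y) \<and> \<not> antimono (\<lambda>y. l y - \<eta> \<omega> * y) \<longrightarrow>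
        value_G \<omega> \<le> U \<omega> + ereal (e * (1 + \<eta> \<omega>))"
      by (rule value_G_le_interior[OF that]) (use U in blast)
    with value_G_le_boundary[OF that] bspec[OF U one_in_densities] show ?thesis
    proof eventually_elim
    case (elim \<omega>)
    have "ereal_cond_exp M G (value_H (\<lambda>_. 1)) \<omega> + ereal (e * (1 + \<eta> \<omega>)) \<le> U \<omega> + ereal (e * (1 + \<eta> \<omega>))"
      using elim(2) by (rule add_right_mono)
    then show ?case using elim(1,3) order_trans by blast
    qed
  qed
  then have "AE \<omega> in M. \<forall>n. value_G \<omega> \<le> U \<omega> + ereal (inverse (real (Suc n)) * (1 + \<eta> \<omega>))"
    by (subst AE_all_countable) simp
  then show "AE \<omega> in M. value_G \<omega> \<le> U \<omega>" using \<eta>_nonneg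
  proof eventually_elim
    case (elim \<omega>)
    show ?case
    proof (rule ereal_le_epsilon2)
      fix e :: real assume "0 < e"
      then obtain n where n: "inverse (real (Suc n)) < e / (1 + \<eta> \<omega>)"
        using reals_Archimedean[of "e / (1 + \<eta> \<omega>)"] elim(2) by auto
      then have "inverse (real (Suc n)) * (1 + \<eta> \<omega>) \<le> e"
        using elim(2) by (simp add: pos_less_divide_eq less_imp_le)
      then have "U \<omega> + ereal (inverse (real (Suc n)) * (1 + \<eta> \<omega>)) \<le> U \<omega> + ereal e"
        by (intro add_left_mono) simp
      with elim(1)[rule_format, of n] show "value_G \<omega> \<le> U \<omega> + ereal e" by (rule order_trans)
    qed
  qed
qed

end

section \<open>Trivial and Brownian \<open>\<sigma>\<close>-algebras\<close>

text \<open>Any version witnesses the choice behind \<open>ess_Sup\<close>, and two versions agree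
  almost surely.\<close>

lemma ess_Sup_eqI:
  assumes "is_ess_Sup M I f Y"
  shows "AE \<omega> in M. Y \<omega> = ess_Sup M I f \<omega>"
proof -
  have "is_ess_Sup M I f (ess_Sup M I f)"
    unfolding ess_Sup_def by (rule someI[of "is_ess_Sup M I f"]) (rule assms)
  with assms show ?thesis by (rule is_ess_Sup_unique)
qed

section \<open>Conditioning on the trivial \<sigma>-algebra\<close>

context prob_space
begin

lemma trivial_subalgebra: "subalgebra M (sigma (space M) {})"
  by (auto simp: subalgebra_def sigma_sets_empty_eq)

interpretation T: finite_measure_subalgebra M "sigma (space M) {}"
  by unfold_locales (rule trivial_subalgebra)

text \<open>Points are closed in a T1 space, so the preimage of an attained value is a nonempty set
  of the trivial \<sigma>-algebra.\<close>

lemma trivial_measurable_const: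
  fixes f :: "'a \<Rightarrow> 'b :: t1_space"
  assumes f: "f \<in> borel_measurable (sigma (space M) {})"
  obtains c where "\<And>\<omega>. \<omega> \<in> space M \<Longrightarrow> f \<omega> = c"
proof -
  obtain \<omega>0 where w: "\<omega>0 \<in> space M" using not_empty by blast
  have "f -` {f \<omega>0} \<inter> space M \<in> {{}, space M}"
    using measurable_sets[OF f, of "{f \<omega>0}"] by (simp add: sigma_sets_empty_eq)
  with w have "f \<omega> = f \<omega>0" if "\<omega> \<in> space M" for \<omega> using that by auto
  then show ?thesis by (rule that)
qed

text \<open>The conditional expectation is constant on the space and has the integral of
  \<open>f\<close>; the identity therefore holds at every point.\<close>

lemma nn_cond_exp_trivial:
  assumes f [measurable]: "f \<in> borel_measurable M" and "\<omega> \<in> space M"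
  shows "nn_cond_exp M (sigma (space M) {}) f \<omega> = (\<integral>\<^sup>+ x. f x \<partial>M)"
proof -
  obtain c where c: "\<And>\<omega>. \<omega> \<in> space M \<Longrightarrow> nn_cond_exp M (sigma (space M) {}) f \<omega> = c"
    using trivial_measurable_const[OF borel_measurable_nn_cond_exp[of M _ f]] by blast
  have "(\<integral>\<^sup>+ x. f x \<partial>M) = (\<integral>\<^sup>+ x. nn_cond_exp M (sigma (space M) {}) f x \<partial>M)"
    using T.nn_cond_exp_intg[of "\<lambda>_. 1" f] by simp
  also have "\<dots> = (\<integral>\<^sup>+ x. c \<partial>M)" by (rule nn_integral_cong) (rule c)
  also have "\<dots> = c" by (simp add: emeasure_space_1)
  finally show ?thesis using c assms(2) by simp
qed

lemma real_cond_exp_trivial: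
  assumes f: "integrable M f" and "\<omega> \<in> space M"
  shows "real_cond_exp M (sigma (space M) {}) f \<omega> = (\<integral>x. f x \<partial>M)"
proof -
  obtain c where c: "\<And>\<omega>. \<omega> \<in> space M \<Longrightarrow> real_cond_exp M (sigma (space M) {}) f \<omega> = c"
    using trivial_measurable_const[OF borel_measurable_cond_exp[of M _ f]] by blast
  have "(\<integral>x. f x \<partial>M) = (\<integral>x. real_cond_exp M (sigma (space M) {}) f x \<partial>M)"
    using T.real_cond_exp_int(2)[OF f] by simp
  also have "\<dots> = (\<integral>x. c \<partial>M)" by (rule Bochner_Integration.integral_cong) (simp_all add: c)
  also have "\<dots> = c" by (simp add: prob_space)
  finally show ?thesis using c assms(2) by simp
qed

lemma ereal_cond_exp_trivial:
  assumes [measurable]: "Y \<in> borel_measurable M" and "\<omega> \<in> space M"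
  shows "ereal_cond_exp M (sigma (space M) {}) Y \<omega> = ereal_expectation M Y"
  using assms(2) by (simp add: ereal_cond_exp_def ereal_expectation_def nn_cond_exp_trivial)

text \<open>The infimum is approached along a sequence, so only countably many null sets have to be
  united even for an uncountable index set.\<close>

lemma is_ess_Inf_const:
  assumes "I \<noteq> {}"
  shows "is_ess_Inf M I (\<lambda>i \<omega>. c i) (\<lambda>_. INF i\<in>I. c i)"
  unfolding is_ess_Inf_def
proof (intro conjI ballI impI)
  show "AE \<omega> in M. (INF i\<in>I. c i) \<le> c i" if "i \<in> I" for i
    using that by (intro AE_I2 INF_lower)
  fix Y' :: "'a \<Rightarrow> ereal" assume Y': "\<forall>i\<in>I. AE \<omega> in M. Y' \<omega> \<le> c i"
  obtain g :: "nat \<Rightarrow> ereal" where g: "range g \<subseteq> c ` I" "Inf (c ` I) = (INF n. g n)"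
    using Inf_countable_INF[of "c ` I"] assms by auto
  have "AE \<omega> in M. Y' \<omega> \<le> g n" for n
  proof -
    obtain i where "i \<in> I" "g n = c i" using g(1) by blast
    then show ?thesis using Y' by simp
  qed
  then have "AE \<omega> in M. \<forall>n. Y' \<omega> \<le> g n" by (simp add: AE_all_countable)
  then show "AE \<omega> in M. Y' \<omega> \<le> (INF i\<in>I. c i)"
    unfolding g(2) by eventually_elim (auto intro: INF_greatest)
qed simp

end

section \<open>The Brownian filtration and the conclusion\<close>

lemma completed_filtration_mono:
  assumes "s \<le> t"
  shows "subalgebra (completed_filtration M W t) (completed_filtration M W s)"
proof -
  let ?g = "\<lambda>t. \<Union>u\<in>{0..t}. {W u -` B \<inter> space M | B. B \<in> sets borel}"
  have natural: "sets (natural_filtration M W s) \<subseteq> sets (natural_filtration M W t)"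
  proof -
    have g: "?g t \<subseteq> Pow (space M)" for t by auto
    have "?g s \<subseteq> ?g t" using assms by fastforce
    then show ?thesis
      unfolding natural_filtration_def sets_measure_of[OF g] by (rule sigma_sets_mono')
  qed
  have Pow: "sets (natural_filtration M W t) \<union> null_sets M \<subseteq> Pow (space M)" for t
    using sets.sets_into_space[of _ "natural_filtration M W t"] sets.sets_into_space[of _ M]
    by (auto simp: natural_filtration_def space_measure_of_conv)
  have sets_completed: "sets (completed_filtration M W t) = sigma_sets (space M) (sets (natural_filtration M W t) \<union> null_sets M)" for t
    unfolding completed_filtration_def by (rule sets_measure_of[OF Pow])
  have "sets (completed_filtration M W s) \<subseteq> sets (completed_filtration M W t)"
    unfolding sets_completed by (intro sigma_sets_mono' Un_mono natural order_refl)
  then show ?thesis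
    by (simp add: subalgebra_def completed_filtration_def space_measure_of_conv)
qed

lemma (in brownian_space) subalgebra_completed_filtration:
  assumes "t \<le> T"
  shows "subalgebra M (completed_filtration M W t)"
  using completed_filtration_mono[OF assms, of M W]
  by (simp add: subalgebra_def sets_eq_terminal completed_filtration_def space_measure_of_conv)

theorem proposition2p11:
  fixes M :: "'w measure" and W :: "real \<Rightarrow> 'w \<Rightarrow> real ^ 'd" and T :: real
    and F :: "real \<Rightarrow> 'w measure" and l :: "real \<Rightarrow> real" and X :: "'w \<Rightarrow> real"
  assumes "brownian_space M W T"
    and F_def: "F = completed_filtration M W"
    and "loss_function l"
    and "X \<in> Linfty M (F T)"
  shows "(\<forall>s t \<eta>. 0 \<le> s \<and> s \<le> t \<and> t \<le> T \<and> \<eta> \<in> L0 (F s) \<and> (AE \<omega> in M. \<eta> \<omega> \<in> conjugate_dom l) \<longrightarrow>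
            (AE \<omega> in M. cond_OCE M F l X s \<eta> \<omega> =
               ess_Sup M (cond_densities M F l s t \<eta>)
                 (\<lambda>Z. ereal_cond_exp M (F s)
                    (ess_Inf M UNIV (\<lambda>r \<omega>. ereal (real_cond_exp M (F t) (\<lambda>\<omega>. l (X \<omega> - r)) \<omega>
                                                   + r * (\<eta> \<omega> * Z \<omega>))))) \<omega>) \<and>
            (AE \<omega> in M. cond_OCE M F l X s \<eta> \<omega> =
               ess_Sup M (cond_densities M F l s t \<eta>)
                 (\<lambda>Z. ereal_cond_exp M (F s) (cond_OCE M F l X t (\<lambda>\<omega>. \<eta> \<omega> * Z \<omega>))) \<omega>))
       \<and> (\<forall>t. 0 \<le> t \<and> t \<le> T \<longrightarrow>
            OCE M l X =
              (SUP Z \<in> {Z \<in> L1_plus M (F t). (AE \<omega> in M. Z \<omega> \<in> conjugate_dom l) \<and> (\<integral>\<omega>. Z \<omega> \<partial>M) = 1}.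
                 ereal_expectation M
                   (ess_Inf M UNIV (\<lambda>r \<omega>. ereal (real_cond_exp M (F t) (\<lambda>\<omega>. l (X \<omega> - r)) \<omega>
                                                  + r * Z \<omega>)))))"
proof -
  interpret brownian_space M W T by (rule assms)
  interpret loss_function l by (rule assms)
  have MF: "subalgebra M (F t)" if "t \<le> T" for t
    unfolding F_def using that by (rule subalgebra_completed_filtration)
  have FF: "subalgebra (F t) (F s)" if "s \<le> t" for s t
    unfolding F_def using that by (rule completed_filtration_mono)
  obtain C where X: "X \<in> borel_measurable M" and C: "AE \<omega> in M. \<bar>X \<omega>\<bar> \<le> C"
    using \<open>X \<in> Linfty M (F T)\<close> measurable_from_subalg[OF MF[of T]] by (auto simp: Linfty_def)
  show ?thesis
  proof (intro conjI allI impI, goal_cases)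
    \<comment> \<open>By its definition, \<open>cond_OCE\<close> at the later time is the inner
      essential infimum, so this case and the next one are the same identity.\<close>
    case (1 s t \<eta>)
    then interpret N: nested_loss M l "F s" "F t" X \<eta> C
      using MF FF X C by unfold_locales (auto simp: L0_def)
    show ?case
      using ess_Sup_eqI[OF N.value_G_is_ess_Sup]
      by (simp only: N.value_G_def N.value_H_def N.densities_def cond_OCE_def cond_densities_def)
  next
    case (2 s t \<eta>)
    then interpret N: nested_loss M l "F s" "F t" X \<eta> C
      using MF FF X C by unfold_locales (auto simp: L0_def)
    show ?case
      using ess_Sup_eqI[OF N.value_G_is_ess_Sup]
      by (simp only: N.value_G_def N.value_H_def N.densities_def cond_OCE_def cond_densities_def)
  next
    case (3 t)
    \<comment> \<open>The trivial \<sigma>-algebra is used instead of \<open>F 0\<close>, which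
      contains all null sets: its conditional expectations are the plain expectations at every
      point.\<close>
    let ?G = "sigma (space M) {}"
    have "subalgebra (F t) ?G"
      using MF[of t] 3 sets.top[of "F t"] by (auto simp: subalgebra_def sigma_sets_empty_eq)
    then interpret N: nested_loss M l ?G "F t" X "\<lambda>_. 1" C
      using 3 MF X C one_in_conjugate_dom by unfold_locales auto
    define e where "e Z = ereal_expectation M (N.value_H Z)" for Z
    have V: "AE \<omega> in M. N.value_G \<omega> = OCE M l X"
    proof (rule is_ess_Inf_unique)
      show "is_ess_Inf M UNIV (\<lambda>r \<omega>. ereal (real_cond_exp M ?G (\<lambda>\<omega>. l (X \<omega> - r)) \<omega> + r * 1)) N.value_G"
        by (rule N.value_G_is_ess_Inf)
      have "(AE \<omega> in M. Y \<omega> \<le> ereal (real_cond_exp M ?G (\<lambda>\<omega>. l (X \<omega> - r)) \<omega> + r * 1))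
          = (AE \<omega> in M. Y \<omega> \<le> ereal ((\<integral>\<omega>. l (X \<omega> - r) \<partial>M) + r))" for Y r
        by (rule AE_cong) (simp add: real_cond_exp_trivial)
      then have "is_ess_Inf M UNIV (\<lambda>r \<omega>. ereal (real_cond_exp M ?G (\<lambda>\<omega>. l (X \<omega> - r)) \<omega> + r * 1)) (\<lambda>_. OCE M l X)
          = is_ess_Inf M UNIV (\<lambda>r \<omega>. ereal ((\<integral>\<omega>. l (X \<omega> - r) \<partial>M) + r)) (\<lambda>_. OCE M l X)"
        unfolding is_ess_Inf_def by (simp only:)
      also have "\<dots>"
        unfolding OCE_def by (rule is_ess_Inf_const) simp
      finally show "is_ess_Inf M UNIV (\<lambda>r \<omega>. ereal (real_cond_exp M ?G (\<lambda>\<omega>. l (X \<omega> - r)) \<omega> + r * 1)) (\<lambda>_. OCE M l X)" .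
    qed
    have D: "N.densities = {Z \<in> L1_plus M (F t). (AE \<omega> in M. Z \<omega> \<in> conjugate_dom l) \<and> (\<integral>\<omega>. Z \<omega> \<partial>M) = 1}"
    proof -
      have mean: "(AE \<omega> in M. real_cond_exp M ?G Z \<omega> = 1) \<longleftrightarrow> (\<integral>\<omega>. Z \<omega> \<partial>M) = 1" if "integrable M Z" for Z
      proof -
        have "(AE \<omega> in M. real_cond_exp M ?G Z \<omega> = 1) \<longleftrightarrow> (AE \<omega> in M. (\<integral>\<omega>. Z \<omega> \<partial>M) = 1)"
          by (rule AE_cong) (simp add: real_cond_exp_trivial[OF that])
        then show ?thesis by simp
      qed
      show ?thesis
        unfolding N.densities_def L1_plus_def by (simp add: mean cong: conj_cong)
    qed
    have cond_e: "AE \<omega> in M. ereal_cond_exp M ?G (N.value_H Z) \<omega> = e Z" if "Z \<in> N.densities" for Z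
      using N.measurable_value_H[OF that] by (intro AE_I2) (simp add: e_def ereal_cond_exp_trivial)
    have "OCE M l X = (SUP Z\<in>N.densities. e Z)"
    proof (rule antisym)
      have "AE \<omega> in M. ereal_cond_exp M ?G (N.value_H Z) \<omega> \<le> (SUP Z\<in>N.densities. e Z)" if "Z \<in> N.densities" for Z
        using cond_e[OF that] by eventually_elim (use that in \<open>auto intro: SUP_upper\<close>)
      then have "AE \<omega> in M. N.value_G \<omega> \<le> (SUP Z\<in>N.densities. e Z)"
        using N.value_G_is_ess_Sup by (auto simp: is_ess_Sup_def)
      with V have "AE \<omega> in M. OCE M l X \<le> (SUP Z\<in>N.densities. e Z)"
        by eventually_elim simp
      \<comment> \<open>An almost sure inequality between constants is a true one, because the space
        has probability 1.\<close>
      then show "OCE M l X \<le> (SUP Z\<in>N.densities. e Z)" by simp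
      show "(SUP Z\<in>N.densities. e Z) \<le> OCE M l X"
      proof (rule SUP_least)
        fix Z assume Z: "Z \<in> N.densities"
        from cond_e[OF Z] N.cond_exp_value_H_le[OF Z] V have "AE \<omega> in M. e Z \<le> OCE M l X"
          by eventually_elim simp
        then show "e Z \<le> OCE M l X" by simp
      qed
    qed
    then show ?case unfolding D by (simp add: e_def N.value_H_def)
  qed
qed

end
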